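(* Let $S$ be a finite regular semigroup and $*$ an involution on $S$. Then $S$ is an inverse semigroup whose inverse map is $*$ (i.e. $ss^{*}s=s$ and $s^{*}ss^{*}=s^{*}$ for all $s$) if and only if, for each $\mathcal{J}$-class of $S$, there exists a pair of matrix Schützenberger representations of $S$ associated to that $\mathcal{J}$-class which are both semiunitary $*$-representations.
   Context: An involution on $S$ is a bijection $*$ with $a^{**}=a$, $(ab)^*=b^*a^*$. For a finite semigroup $S$: $S^1$ is $S$ with identity adjoined if necessary; $L_e=\{x:S^1x=S^1e\}$, $R_e=\{x:xS^1=eS^1\}$, $G_e=L_e\cap R_e$ for an idempotent $e$. $S$ regular: each $a$ has $b$ with $aba=a$ (so each $\mathcal{J}$-class contains an idempotent). Inverse: each $a$ has a unique $b$ with $aba=a$, $bab=b$. Matrix Schützenberger representations: pick an idempotent $e$ in the $\mathcal{J}$-class, $x_1,\dots,x_s\in L_e$, $y_1,\dots,y_t\in R_e$ with $L_e=\bigsqcup x_iG_e$, $R_e=\bigsqcup G_ey_j$, and $\sigma=\sigma_1\oplus\cdots\oplus\sigma_r$ with $\sigma_1,\dots,\sigma_r$ a complete set of pairwise inequivalent irreducible matrix representations of $G_e$, $\sigma(0)=0$. For $u\in S$: if $ux_i\in L_e$, $ux_i=x_jg_{ji}$ with unique $g_{ji}\in G_e$, other entries $0$, and $\mathrm{Ind}_{G_e}(\sigma)(u)=(\sigma(g_{ji}))$; if $y_ju\in R_e$, $y_ju=h_{ji}y_i$ with unique $h_{ji}\in G_e$, other entries $0$, and $\mathrm{Coind}_{G_e}(\sigma)(u)=(\sigma(h_{ji}))$.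 The pair $(\mathrm{Ind}_{G_e}(\sigma),\mathrm{Coind}_{G_e}(\sigma))$ is a pair of matrix Schützenberger representations. A matrix representation $\rho$ is semiunitary if $\rho(u)\rho(u)^*\rho(u)=\rho(u)$, and a $*$-representation if $\rho(u^* )=\rho(u)^*$ (conjugate transpose), for all $u\in S$. *)

theory Defs
  imports Complex_Main "Jordan_Normal_Form.Matrix" "Jordan_Normal_Form.Schur_Decomposition"
begin

text \<open>The finite semigroup S is the whole (finite) type 'a with multiplication.
  S^1 x = insert x (S x) etc.\<close>

definition is_involution :: "('a::semigroup_mult \<Rightarrow> 'a) \<Rightarrow> bool" where
  "is_involution star \<longleftrightarrow> bij star \<and> (\<forall>a. star (star a) = a) \<and>
     (\<forall>a b. star (a * b) = star b * star a)"

definition regular_semigroup :: "'a::semigroup_mult itself \<Rightarrow> bool" where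
  "regular_semigroup _ \<longleftrightarrow> (\<forall>a::'a. \<exists>b. a * b * a = a)"

definition inverse_semigroup :: "'a::semigroup_mult itself \<Rightarrow> bool" where
  "inverse_semigroup _ \<longleftrightarrow> (\<forall>a::'a. \<exists>!b. a * b * a = a \<and> b * a * b = b)"

definition left_ideal :: "'a::semigroup_mult \<Rightarrow> 'a set" where
  "left_ideal x = insert x (range (\<lambda>s. s * x))"

definition right_ideal :: "'a::semigroup_mult \<Rightarrow> 'a set" where
  "right_ideal x = insert x (range (\<lambda>s. x * s))"

definition two_ideal :: "'a::semigroup_mult \<Rightarrow> 'a set" where
  "two_ideal x = insert x (range (\<lambda>s. s * x) \<union> range (\<lambda>s. x * s) \<union>
      (\<Union>s. range (\<lambda>t. s * x * t)))"

definition L_class :: "'a::semigroup_mult \<Rightarrow> 'a set" where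
  "L_class e = {x. left_ideal x = left_ideal e}"

definition R_class :: "'a::semigroup_mult \<Rightarrow> 'a set" where
  "R_class e = {x. right_ideal x = right_ideal e}"

definition J_class :: "'a::semigroup_mult \<Rightarrow> 'a set" where
  "J_class a = {x. two_ideal x = two_ideal a}"

definition H_group :: "'a::semigroup_mult \<Rightarrow> 'a set" where
  "H_group e = L_class e \<inter> R_class e"

definition group_matrix_rep :: "'a::semigroup_mult set \<Rightarrow> 'a \<Rightarrow> nat \<Rightarrow> ('a \<Rightarrow> complex mat) \<Rightarrow> bool" where
  "group_matrix_rep G e d \<sigma> \<longleftrightarrow>
     (\<forall>g\<in>G. \<sigma> g \<in> carrier_mat d d) \<and> \<sigma> e = 1\<^sub>m d \<and>
     (\<forall>g\<in>G. \<forall>h\<in>G. \<sigma> (g * h) = \<sigma> g * \<sigma> h)"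

definition invariant_subspace :: "'a set \<Rightarrow> nat \<Rightarrow> ('a \<Rightarrow> complex mat) \<Rightarrow> complex vec set \<Rightarrow> bool" where
  "invariant_subspace G d \<sigma> W \<longleftrightarrow>
     W \<subseteq> carrier_vec d \<and> 0\<^sub>v d \<in> W \<and>
     (\<forall>v\<in>W. \<forall>w\<in>W. v + w \<in> W) \<and> (\<forall>c. \<forall>v\<in>W. c \<cdot>\<^sub>v v \<in> W) \<and>
     (\<forall>g\<in>G. \<forall>v\<in>W. \<sigma> g *\<^sub>v v \<in> W)"

definition irreducible_rep :: "'a::semigroup_mult set \<Rightarrow> 'a \<Rightarrow> nat \<Rightarrow> ('a \<Rightarrow> complex mat) \<Rightarrow> bool" where
  "irreducible_rep G e d \<sigma> \<longleftrightarrow> group_matrix_rep G e d \<sigma> \<and> d > 0 \<and>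
     (\<forall>W. invariant_subspace G d \<sigma> W \<longrightarrow> W = {0\<^sub>v d} \<or> W = carrier_vec d)"

definition equivalent_reps :: "'a set \<Rightarrow> nat \<Rightarrow> ('a \<Rightarrow> complex mat) \<Rightarrow> nat \<Rightarrow> ('a \<Rightarrow> complex mat) \<Rightarrow> bool" where
  "equivalent_reps G d \<sigma> d' \<tau> \<longleftrightarrow> d = d' \<and>
     (\<exists>P Q. P \<in> carrier_mat d d \<and> Q \<in> carrier_mat d d \<and> P * Q = 1\<^sub>m d \<and> Q * P = 1\<^sub>m d \<and>
        (\<forall>g\<in>G. P * \<sigma> g = \<tau> g * P))"

definition complete_irreps :: "'a::semigroup_mult set \<Rightarrow> 'a \<Rightarrow> (nat \<times> ('a \<Rightarrow> complex mat)) list \<Rightarrow> bool" where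
  "complete_irreps G e sigs \<longleftrightarrow>
     (\<forall>k < length sigs. irreducible_rep G e (fst (sigs!k)) (snd (sigs!k))) \<and>
     (\<forall>k < length sigs. \<forall>l < length sigs. k \<noteq> l \<longrightarrow>
        \<not> equivalent_reps G (fst (sigs!k)) (snd (sigs!k)) (fst (sigs!l)) (snd (sigs!l))) \<and>
     (\<forall>d \<tau>. irreducible_rep G e d \<tau> \<longrightarrow>
        (\<exists>k < length sigs. equivalent_reps G d \<tau> (fst (sigs!k)) (snd (sigs!k))))"

fun diag_blocks :: "complex mat list \<Rightarrow> complex mat" where
  "diag_blocks [] = 0\<^sub>m 0 0"
| "diag_blocks (A # As) =
     (let B = diag_blocks As in
      four_block_mat A (0\<^sub>m (dim_row A) (dim_col B)) (0\<^sub>m (dim_row B) (dim_col A)) B)"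

definition direct_sum_rep :: "(nat \<times> ('a \<Rightarrow> complex mat)) list \<Rightarrow> 'a \<Rightarrow> complex mat" where
  "direct_sum_rep sigs g = diag_blocks (map (\<lambda>p. snd p g) sigs)"

definition rep_dim :: "(nat \<times> ('a \<Rightarrow> complex mat)) list \<Rightarrow> nat" where
  "rep_dim sigs = sum_list (map fst sigs)"

definition left_transversal :: "'a::semigroup_mult \<Rightarrow> 'a list \<Rightarrow> bool" where
  "left_transversal e xs \<longleftrightarrow> set xs \<subseteq> L_class e \<and>
     L_class e = (\<Union>i<length xs. (\<lambda>g. xs!i * g) ` H_group e) \<and>
     (\<forall>i<length xs. \<forall>j<length xs. i \<noteq> j \<longrightarrow>
        (\<lambda>g. xs!i * g) ` H_group e \<inter> (\<lambda>g. xs!j * g) ` H_group e = {})"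

definition right_transversal :: "'a::semigroup_mult \<Rightarrow> 'a list \<Rightarrow> bool" where
  "right_transversal e ys \<longleftrightarrow> set ys \<subseteq> R_class e \<and>
     R_class e = (\<Union>i<length ys. (\<lambda>g. g * ys!i) ` H_group e) \<and>
     (\<forall>i<length ys. \<forall>j<length ys. i \<noteq> j \<longrightarrow>
        (\<lambda>g. g * ys!i) ` H_group e \<inter> (\<lambda>g. g * ys!j) ` H_group e = {})"

text \<open>Ind_{G_e}(sigma)(u): block (j,i) is sigma(g_ji) if u x_i in L_e and u x_i = x_j g_ji,
  otherwise the zero block.\<close>
definition Ind_rep :: "'a::semigroup_mult \<Rightarrow> 'a list \<Rightarrow> (nat \<times> ('a \<Rightarrow> complex mat)) list \<Rightarrow> 'a \<Rightarrow> complex mat" where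
  "Ind_rep e xs sigs u =
    (let D = rep_dim sigs; n = length xs in
     mat (n * D) (n * D) (\<lambda>(p, q).
       let j = p div D; i = q div D in
       if u * xs!i \<in> L_class e \<and> (\<exists>g\<in>H_group e. u * xs!i = xs!j * g)
       then direct_sum_rep sigs (THE g. g \<in> H_group e \<and> u * xs!i = xs!j * g) $$ (p mod D, q mod D)
       else 0))"

text \<open>Coind_{G_e}(sigma)(u): block (j,i) is sigma(h_ji) if y_j u in R_e and y_j u = h_ji y_i.\<close>
definition Coind_rep :: "'a::semigroup_mult \<Rightarrow> 'a list \<Rightarrow> (nat \<times> ('a \<Rightarrow> complex mat)) list \<Rightarrow> 'a \<Rightarrow> complex mat" where
  "Coind_rep e ys sigs u =
    (let D = rep_dim sigs; n = length ys in
     mat (n * D) (n * D) (\<lambda>(p, q).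
       let j = p div D; i = q div D in
       if ys!j * u \<in> R_class e \<and> (\<exists>h\<in>H_group e. ys!j * u = h * ys!i)
       then direct_sum_rep sigs (THE h. h \<in> H_group e \<and> ys!j * u = h * ys!i) $$ (p mod D, q mod D)
       else 0))"

definition semiunitary :: "('a \<Rightarrow> complex mat) \<Rightarrow> bool" where
  "semiunitary \<rho> \<longleftrightarrow> (\<forall>u. \<rho> u * mat_adjoint (\<rho> u) * \<rho> u = \<rho> u)"

definition star_rep :: "('a \<Rightarrow> 'a) \<Rightarrow> ('a \<Rightarrow> complex mat) \<Rightarrow> bool" where
  "star_rep star \<rho> \<longleftrightarrow> (\<forall>u. \<rho> (star u) = mat_adjoint (\<rho> u))"

definition good_schutzenberger_pair :: "('a::semigroup_mult \<Rightarrow> 'a) \<Rightarrow> 'a \<Rightarrow> bool" where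
  "good_schutzenberger_pair star a \<longleftrightarrow>
     (\<exists>e xs ys sigs. e \<in> J_class a \<and> e * e = e \<and>
        left_transversal e xs \<and> right_transversal e ys \<and>
        complete_irreps (H_group e) e sigs \<and>
        semiunitary (Ind_rep e xs sigs) \<and> star_rep star (Ind_rep e xs sigs) \<and>
        semiunitary (Coind_rep e ys sigs) \<and> star_rep star (Coind_rep e ys sigs))"

end

theory Submission
  imports Defs
begin

text \<open>
  Let \<open>\<sigma>\<close> be the direct sum of the irreducible representations of \<open>G\<^sub>e\<close>. \<open>Ind(\<sigma>)\<close> is multiplicative and
  \<open>\<sigma>\<close> is faithful, so \<open>Ind(\<sigma>)(u)\<close> determines the partial action of \<open>u\<close> on \<open>L\<^sub>e\<close> by left
  multiplication. If \<open>Ind(\<sigma>)\<close> is a semiunitary *-representation, then \<open>a\<close> and \<open>a a\<^sup>* a\<close> act alike, and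
  writing \<open>a' a = x y\<close> with \<open>x \<in> L\<^sub>e\<close> and \<open>a x \<in> L\<^sub>e\<close> gives \<open>a a\<^sup>* a = a\<close>. An idempotent \<open>f\<close>
  has a monomial idempotent matrix whose adjoint is of the same kind, hence a diagonal one, so \<open>f\<^sup>* = f\<close>.
  Idempotents that are all self-adjoint commute, and \<open>S\<close> is inverse.

  Conversely, take \<open>e = a a\<^sup>*\<close>, any \<open>x\<^sub>i\<close>, the transversal \<open>y\<^sub>i = x\<^sub>i\<^sup>*\<close>, and unitary irreducible
  representations. In an inverse semigroup \<open>u x\<^sub>i = x\<^sub>j g\<close> is equivalent to \<open>u\<^sup>* x\<^sub>j = x\<^sub>i g\<^sup>*\<close>, whence
  \<open>Ind(\<sigma>)(u\<^sup>*) = Ind(\<sigma>)(u)\<^sup>*\<close> and \<open>Coind(\<sigma>) = Ind(\<sigma>)\<close>.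
\<close>

section \<open>Green's relations\<close>

text \<open>Both uses of \<open>\<sigma>\<close> rest on facts about finite groups that are proved
  here from the functions on \<open>H_group e\<close>. Faithfulness needs the irreducible
  representations to separate points, and the converse needs a complete list of unitary ones:
  \<open>complete_irreps\<close> speaks of a finite list, so a bound on the number of equivalence
  classes has to be found first. One invariant Hermitian form on functions supplies all of this.
  Dimension is the greatest length of an orthonormal family, every irreducible representation embeds
  into the functions and becomes unitary there, and orthogonality of matrix coefficients bounds the
  number of classes by the order of the group. On the semigroup side the obstacle is that
  \<open>Ind\<close> sees an element only on one L-class, and only where the product stays in that
  class. Stability of finite semigroups bridges the gap: it gives each \<open>a\<close> a point
  \<open>x\<close> of the class at which \<open>a\<close> is defined and from which \<open>a\<close>
  can be recovered, as \<open>a = (a * x) * y\<close>.\<close>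

lemma L_class_iff:
  fixes e :: "'a::semigroup_mult"
  assumes "e * e = e"
  shows "x \<in> L_class e \<longleftrightarrow> x * e = x \<and> (\<exists>t. t * x = e)"
proof
  assume "x \<in> L_class e"
  hence eq: "left_ideal x = left_ideal e" by (simp add: L_class_def)
  have "x \<in> left_ideal e" using eq by (auto simp: left_ideal_def)
  hence 1: "x * e = x" using assms by (auto simp: left_ideal_def mult.assoc)
  have "e \<in> left_ideal x" using eq by (auto simp: left_ideal_def)
  \<comment> \<open>The adjoined identity of S^1 disappears because \<open>e\<close> is idempotent:
    in the case \<open>e = x\<close> the witness is \<open>e\<close> itself.\<close>
  hence "\<exists>t. t * x = e" using assms by (auto simp: left_ideal_def)
  with 1 show "x * e = x \<and> (\<exists>t. t * x = e)" by simp
next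
  assume "x * e = x \<and> (\<exists>t. t * x = e)"
  then obtain t where 1: "x * e = x" and 2: "t * x = e" by auto
  have "left_ideal x \<subseteq> left_ideal e"
  proof
    fix z assume "z \<in> left_ideal x"
    hence "z = x * e \<or> (\<exists>s. z = (s * x) * e)" using 1 by (auto simp: left_ideal_def mult.assoc)
    thus "z \<in> left_ideal e" by (auto simp: left_ideal_def)
  qed
  moreover have "left_ideal e \<subseteq> left_ideal x"
  proof
    fix z assume "z \<in> left_ideal e"
    hence "z = t * x \<or> (\<exists>s. z = (s * t) * x)" using 2 by (auto simp: left_ideal_def mult.assoc)
    thus "z \<in> left_ideal x" by (auto simp: left_ideal_def)
  qed
  ultimately show "x \<in> L_class e" by (simp add: L_class_def)
qed

lemma R_class_iff:
  fixes e :: "'a::semigroup_mult"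
  assumes "e * e = e"
  shows "x \<in> R_class e \<longleftrightarrow> e * x = x \<and> (\<exists>t. x * t = e)"
proof
  assume "x \<in> R_class e"
  hence eq: "right_ideal x = right_ideal e" by (simp add: R_class_def)
  have "x \<in> right_ideal e" using eq by (auto simp: right_ideal_def)
  hence 1: "e * x = x" using assms by (auto simp: right_ideal_def mult.assoc[symmetric])
  have "e \<in> right_ideal x" using eq by (auto simp: right_ideal_def)
  hence "\<exists>t. x * t = e" using assms by (auto simp: right_ideal_def)
  with 1 show "e * x = x \<and> (\<exists>t. x * t = e)" by simp
next
  assume "e * x = x \<and> (\<exists>t. x * t = e)"
  then obtain t where 1: "e * x = x" and 2: "x * t = e" by auto
  have "right_ideal x \<subseteq> right_ideal e"
  proof
    fix z assume "z \<in> right_ideal x"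
    hence "z = e * x \<or> (\<exists>s. z = e * (x * s))"
      using 1 by (auto simp: right_ideal_def mult.assoc[symmetric])
    thus "z \<in> right_ideal e" by (auto simp: right_ideal_def)
  qed
  moreover have "right_ideal e \<subseteq> right_ideal x"
  proof
    fix z assume "z \<in> right_ideal e"
    hence "z = x * t \<or> (\<exists>s. z = x * (t * s))"
      using 2 by (auto simp: right_ideal_def mult.assoc[symmetric])
    thus "z \<in> right_ideal x" by (auto simp: right_ideal_def)
  qed
  ultimately show "x \<in> R_class e" by (simp add: R_class_def)
qed

section \<open>Subgroups of a semigroup and the group of an idempotent\<close>

locale subgroup_of_semigroup =
  fixes G :: "'a::semigroup_mult set" and e :: 'a and gi :: "'a \<Rightarrow> 'a"
  assumes e_in [simp]: "e \<in> G"
    and mult_in [simp]: "g \<in> G \<Longrightarrow> h \<in> G \<Longrightarrow> g * h \<in> G"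
    and gi_in [simp]: "g \<in> G \<Longrightarrow> gi g \<in> G"
    and e_left [simp]: "g \<in> G \<Longrightarrow> e * g = g"
    and e_right [simp]: "g \<in> G \<Longrightarrow> g * e = g"
    and gi_left [simp]: "g \<in> G \<Longrightarrow> gi g * g = e"
    and gi_right [simp]: "g \<in> G \<Longrightarrow> g * gi g = e"
begin

lemma gi_unique:
  assumes "g \<in> G" "h \<in> G" "g * h = e"
  shows "h = gi g"
proof -
  have "h = (gi g * g) * h" using assms(1,2) by simp
  also have "\<dots> = gi g" using assms(1) unfolding mult.assoc assms(3) by simp
  finally show ?thesis .
qed

lemma gi_gi [simp]: "g \<in> G \<Longrightarrow> gi (gi g) = g"
  using gi_unique[of "gi g" g] by simp

lemma gi_cancel [simp]:
  assumes "g \<in> G" "h \<in> G"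
  shows "gi g * (g * h) = h" "g * (gi g * h) = h" "(h * g) * gi g = h" "(h * gi g) * g = h"
proof -
  have "gi g * g * h = h" "g * gi g * h = h" "h * (g * gi g) = h" "h * (gi g * g) = h"
    using assms by simp_all
  thus "gi g * (g * h) = h" "g * (gi g * h) = h" "(h * g) * gi g = h" "(h * gi g) * g = h"
    unfolding mult.assoc by simp_all
qed

lemma bij_betw_right_mult: "g \<in> G \<Longrightarrow> bij_betw (\<lambda>x. x * g) G G"
  by (rule bij_betw_byWitness[where f' = "\<lambda>x. x * gi g"]) (auto simp: mult.assoc)

lemma bij_betw_left_mult: "g \<in> G \<Longrightarrow> bij_betw (\<lambda>x. g * x) G G"
  by (rule bij_betw_byWitness[where f' = "\<lambda>x. gi g * x"]) auto

end

lemma H_group_iff: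
  fixes e :: "'a::semigroup_mult"
  assumes "e * e = e"
  shows "g \<in> H_group e \<longleftrightarrow> g * e = g \<and> e * g = g \<and> (\<exists>t. t * g = e) \<and> (\<exists>t. g * t = e)"
  using assms by (auto simp: H_group_def L_class_iff R_class_iff)

lemma H_group_inverse_exists:
  fixes e :: "'a::semigroup_mult"
  assumes e: "e * e = e" and "g \<in> H_group e"
  shows "\<exists>h\<in>H_group e. h * g = e \<and> g * h = e"
proof -
  obtain s t where g: "g * e = g" "e * g = g" "s * g = e" "g * t = e"
    using assms by (auto simp: H_group_iff)
  \<comment> \<open>Compressing the right inverse \<open>t\<close> by \<open>e\<close> puts it into
    the group. It is also a left inverse, since it agrees with the compression
    \<open>e * s * e\<close> of the left inverse \<open>s\<close>.\<close>
  define h where "h = e * t * e"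
  have r: "g * h = e"
    by (metis e g(1) g(4) h_def mult.assoc)
  have se: "e * s * e = h"
    by (metis e g(2) g(3) h_def mult.assoc r)
  have l: "h * g = e"
    by (metis e g(2) g(3) se mult.assoc)
  have "h * e = h" "e * h = h" using e by (auto simp: h_def mult.assoc) (metis mult.assoc e)
  hence "h \<in> H_group e" using l r e unfolding H_group_iff[OF e] by blast
  thus ?thesis using l r by blast
qed

definition H_inv :: "'a::semigroup_mult \<Rightarrow> 'a \<Rightarrow> 'a" where
  "H_inv e g = (SOME h. h \<in> H_group e \<and> h * g = e \<and> g * h = e)"

lemma subgroup_H_group:
  fixes e :: "'a::semigroup_mult"
  assumes e: "e * e = e"
  shows "subgroup_of_semigroup (H_group e) e (H_inv e)"
proof -
  have inv: "H_inv e g \<in> H_group e \<and> H_inv e g * g = e \<and> g * H_inv e g = e" if "g \<in> H_group e" for g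
    unfolding H_inv_def using H_group_inverse_exists[OF e that] by (rule someI2_bex) auto
  show ?thesis
  proof
    show "e \<in> H_group e" using e by (auto simp: H_group_iff)
    fix g h assume g: "g \<in> H_group e" and h: "h \<in> H_group e"
    have "H_inv e h * H_inv e g * (g * h) = e"
      by (metis H_group_iff e g h inv mult.assoc)
    moreover have "(g * h) * (H_inv e h * H_inv e g) = e"
      by (metis H_group_iff e g h inv mult.assoc)
    moreover have "g * h * e = g * h" "e * (g * h) = g * h"
      using e g h by (auto simp: H_group_iff mult.assoc) (metis mult.assoc)
    ultimately show "g * h \<in> H_group e" using e by (auto simp: H_group_iff)
  qed (use inv e in \<open>auto simp: H_group_iff\<close>)
qed

section \<open>The partial action on an L-class, stability, and J-classes\<close>

lemma L_class_cancel:
  fixes e :: "'a::semigroup_mult"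
  assumes e: "e * e = e" and x: "x \<in> L_class e"
    and g: "g \<in> H_group e" "h \<in> H_group e" and eq: "x * g = x * h"
  shows "g = h"
proof -
  obtain t where "t * x = e" using x e by (auto simp: L_class_iff)
  hence "e * g = e * h" using eq by (metis mult.assoc)
  thus ?thesis using g e by (simp add: H_group_iff)
qed

lemma L_class_mult_H:
  fixes e :: "'a::semigroup_mult"
  assumes e: "e * e = e" and x: "x \<in> L_class e" and g: "g \<in> H_group e"
  shows "x * g \<in> L_class e"
proof -
  obtain t s where "t * x = e" "s * g = e" "g * e = g" "e * g = g"
    using x g e by (auto simp: L_class_iff H_group_iff)
  hence "(s * t) * (x * g) = e" "x * g * e = x * g" by (metis mult.assoc)+
  thus ?thesis using e by (auto simp: L_class_iff)
qed

text \<open>A product that has left \<open>L_class e\<close> cannot return to it. This makes left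
  multiplication a partial action, and the zero blocks of \<open>Ind_rep\<close> compatible with
  products.\<close>

lemma L_class_of_mult:
  fixes e :: "'a::semigroup_mult"
  assumes e: "e * e = e" and x: "x * e = x" and ux: "u * x \<in> L_class e"
  shows "x \<in> L_class e"
proof -
  obtain t where "t * (u * x) = e" using ux e by (auto simp: L_class_iff)
  hence "(t * u) * x = e" by (simp add: mult.assoc)
  thus ?thesis using x e by (auto simp: L_class_iff)
qed

text \<open>Stability of finite semigroups: a one-sided inverse in the finite monoid \<open>eSe\<close> is two-sided.\<close>

lemma L_class_stable:
  fixes e :: "'a::{semigroup_mult,finite}"
  assumes e: "e * e = e" and x: "x * e = x" and cxd: "c * x * d = e"
  shows "x \<in> L_class e"
proof -
  define M where "M = {z::'a. e * z = z \<and> z * e = z}"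
  define m where "m = e * c * x"
  define k where "k = e * d * e"
  have mM: "m \<in> M" using e x by (simp add: M_def m_def mult.assoc) (metis mult.assoc)
  have kM: "k \<in> M" using e by (simp add: M_def k_def mult.assoc) (metis mult.assoc)
  have mk: "m * k = e" unfolding m_def k_def by (metis e x cxd mult.assoc)
  \<comment> \<open>Left multiplication by \<open>m\<close> undoes left multiplication by
    \<open>k\<close> on \<open>M\<close>, so finiteness makes the latter surjective. A solution of
    \<open>k * z = e\<close> then has to be \<open>m\<close>, hence \<open>k * m = e\<close> as
    well.\<close>
  have "inj_on (\<lambda>z. k * z) M"
    by (rule inj_onI) (metis (mono_tags) M_def mem_Collect_eq mk mult.assoc)
  moreover have "(\<lambda>z. k * z) ` M \<subseteq> M"
    using kM by (auto simp: M_def mult.assoc) (metis mult.assoc)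
  ultimately have "(\<lambda>z. k * z) ` M = M" by (intro endo_inj_surj) auto
  moreover have "e \<in> M" using e by (simp add: M_def)
  ultimately obtain z where z: "z \<in> M" "k * z = e" by (metis (mono_tags, lifting) imageE)
  have "(m * k) * z = z" using z(1) unfolding mk by (simp add: M_def)
  hence "z = m * e" unfolding mult.assoc z(2) by simp
  hence "z = m" using mM by (simp add: M_def)
  hence "(k * e * c) * x = e" using z by (simp add: m_def mult.assoc)
  thus ?thesis using x e by (auto simp: L_class_iff)
qed

lemma two_ideal_iff:
  fixes e :: "'a::semigroup_mult"
  shows "z \<in> two_ideal e \<longleftrightarrow>
    z = e \<or> (\<exists>s. z = s * e) \<or> (\<exists>s. z = e * s) \<or> (\<exists>s t. z = s * e * t)"
  by (simp add: two_ideal_def image_iff)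

lemma two_ideal_idem:
  fixes e :: "'a::semigroup_mult"
  assumes "e * e = e" "z \<in> two_ideal e"
  shows "\<exists>p q. z = p * e * q"
proof -
  have "z = e \<or> (\<exists>s. z = s * e) \<or> (\<exists>s. z = e * s) \<or> (\<exists>s t. z = s * e * t)"
    using assms(2) unfolding two_ideal_iff .
  moreover have "e = e * e * e" "s * e = s * e * e" "e * s = e * e * s" for s
    using assms(1) by (simp_all add: mult.assoc)
  ultimately show ?thesis by blast
qed

lemma two_ideal_mult_subset:
  fixes x y :: "'a::semigroup_mult"
  shows "two_ideal (s * y) \<subseteq> two_ideal y" "two_ideal (y * s) \<subseteq> two_ideal y"
proof -
  have "z \<in> two_ideal y" if "z \<in> two_ideal (s * y)" for z
    using that unfolding two_ideal_iff by (elim disjE exE) (simp add: mult.assoc[symmetric], blast)+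
  moreover have "z \<in> two_ideal y" if "z \<in> two_ideal (y * s)" for z
    using that unfolding two_ideal_iff
    by (elim disjE exE) (simp add: mult.assoc, metis mult.assoc)+
  ultimately show "two_ideal (s * y) \<subseteq> two_ideal y" "two_ideal (y * s) \<subseteq> two_ideal y"
    by blast+
qed

text \<open>The idempotent \<open>f = a' * a\<close> satisfies \<open>a * f = a\<close> and shares
  the J-class of \<open>a\<close> and \<open>e\<close>, so \<open>f = p * e * q\<close>. The left
  factor is moved into the L-class of \<open>e\<close> by stability, because \<open>e\<close> lies
  in the ideal of \<open>f\<close>. Consequently \<open>a = (a * x) * y\<close> is known as soon as
  its action on the single point \<open>x\<close> is known.\<close>

lemma J_class_factorization:
  fixes a e :: "'a::{semigroup_mult,finite}"
  assumes e: "e * e = e" and J: "e \<in> J_class a" and a': "a * a' * a = a"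
  obtains x y where "x \<in> L_class e" "a * x \<in> L_class e" "a' * a = x * y"
proof -
  define f where "f = a' * a"
  have ff: "f * f = f" and af: "a * f = a" using a' by (simp_all add: f_def mult.assoc)
  have "two_ideal f = two_ideal a"
    using two_ideal_mult_subset(1)[of a' a] two_ideal_mult_subset(1)[of a f] af by (simp add: f_def)
  hence fe: "two_ideal f = two_ideal e" using J by (simp add: J_class_def)
  have "f \<in> two_ideal e" by (simp add: fe[symmetric] two_ideal_iff)
  then obtain p q where pq: "f = p * e * q" using two_ideal_idem[OF e] by blast
  have "e \<in> two_ideal f" by (simp add: fe two_ideal_iff)
  then obtain c d where cd: "e = c * f * d" using two_ideal_idem[OF ff] by blast
  define x where "x = f * p * e"
  define y where "y = e * q"
  have xy: "x * y = f" unfolding x_def y_def by (metis e ff mult.assoc pq)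
  have xe: "x * e = x" using e by (simp add: x_def mult.assoc)
  have "c * x * (y * d) = e" using xy cd by (metis mult.assoc)
  with e xe have "x \<in> L_class e" by (rule L_class_stable)
  \<comment> \<open>Multiplying by \<open>a'\<close> undoes \<open>a\<close> on \<open>x\<close>,
    because \<open>a' * a = f\<close> and \<open>f * f = f\<close>; stability therefore applies to
    \<open>a * x\<close> too.\<close>
  moreover have "(c * a') * (a * x) * (y * d) = e"
    using xy cd ff unfolding f_def by (metis mult.assoc)
  hence "a * x \<in> L_class e" by (rule L_class_stable[OF e, rotated]) (simp add: xe mult.assoc)
  ultimately show thesis using that[of x y] xy by (simp add: f_def)
qed

section \<open>Existence of transversals\<close>

lemma left_transversal_exists:
  fixes e :: "'a::{semigroup_mult,finite}"
  assumes e: "e * e = e"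
  obtains xs where "left_transversal e xs"
proof -
  interpret subgroup_of_semigroup "H_group e" e "H_inv e" by (rule subgroup_H_group[OF e])
  define co where "co x = (\<lambda>g. x * g) ` H_group e" for x
  have coset_eq: "co x = co y" if xy: "x \<in> L_class e" "y \<in> L_class e" "co x \<inter> co y \<noteq> {}" for x y
  proof -
    \<comment> \<open>One common element \<open>x * g = y * h\<close> already gives
      \<open>x = y * (h * H_inv e g)\<close>, and so the inclusion of the whole coset.\<close>
    have *: "co x \<subseteq> co y" if "x \<in> L_class e" "g \<in> H_group e" "h \<in> H_group e" "x * g = y * h" for x y g h
    proof -
      have "x = x * (g * H_inv e g)" using that e by (simp add: L_class_iff)
      hence x: "x = y * (h * H_inv e g)" using that(4) by (metis mult.assoc)
      have "x * k \<in> co y" if "k \<in> H_group e" for k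
        unfolding co_def using \<open>g \<in> _\<close> \<open>h \<in> _\<close> that
        by (intro image_eqI[of _ _ "h * H_inv e g * k"]) (subst x, simp_all add: mult.assoc)
      thus ?thesis by (auto simp: co_def)
    qed
    obtain g h where "g \<in> H_group e" "h \<in> H_group e" "x * g = y * h"
      using xy(3) by (auto simp: co_def)
    thus ?thesis using *[of x g h y] *[of y h g x] xy by auto
  qed
  define C where "C = co ` L_class e"
  \<comment> \<open>The list enumerates cosets, not points, so that its distinctness becomes
    disjointness of the cosets of the chosen representatives.\<close>
  obtain cs where cs: "set cs = C" "distinct cs"
    using finite_distinct_list[of C] by auto
  define r where "r c = (SOME x. x \<in> L_class e \<and> co x = c)" for c
  have r: "r c \<in> L_class e \<and> co (r c) = c" if "c \<in> C" for c
    unfolding r_def by (rule someI_ex) (use that in \<open>auto simp: C_def\<close>)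
  define xs where "xs = map r cs"
  have co_xs: "co (xs ! i) = cs ! i" and xs_L: "xs ! i \<in> L_class e" if "i < length xs" for i
    using r[of "cs ! i"] that cs by (auto simp: xs_def)
  have "left_transversal e xs"
    unfolding left_transversal_def co_def[symmetric]
  proof (intro conjI allI impI)
    show "set xs \<subseteq> L_class e" using xs_L by (auto simp: in_set_conv_nth)
    show "L_class e = (\<Union>i<length xs. co (xs ! i))"
    proof
      show "L_class e \<subseteq> (\<Union>i<length xs. co (xs ! i))"
      proof
        fix x assume x: "x \<in> L_class e"
        then obtain i where "i < length cs" "cs ! i = co x" using cs(1) by (metis C_def imageI in_set_conv_nth)
        moreover have "x \<in> co x" unfolding co_def
          using x e by (intro image_eqI[of _ _ e]) (auto simp: L_class_iff)
        ultimately show "x \<in> (\<Union>i<length xs. co (xs ! i))" using co_xs by (auto simp: xs_def)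
      qed
      show "(\<Union>i<length xs. co (xs ! i)) \<subseteq> L_class e"
        using xs_L L_class_mult_H[OF e] by (auto simp: co_def)
    qed
    fix i j assume ij: "i < length xs" "j < length xs" "i \<noteq> j"
    show "co (xs ! i) \<inter> co (xs ! j) = {}"
    proof (rule ccontr)
      assume "co (xs ! i) \<inter> co (xs ! j) \<noteq> {}"
      hence "cs ! i = cs ! j" using coset_eq xs_L ij co_xs by metis
      thus False using ij cs by (simp add: nth_eq_iff_index_eq xs_def)
    qed
  qed
  thus thesis by (rule that)
qed

section \<open>Matrices and equivalence of representations\<close>

lemma mat_adjoint_dim [simp]:
  "dim_row (mat_adjoint A) = dim_col A" "dim_col (mat_adjoint A) = dim_row A"
  by (simp_all add: mat_adjoint_def)

lemma mat_adjoint_carrier [simp]: "A \<in> carrier_mat m n \<Longrightarrow> mat_adjoint A \<in> carrier_mat n m"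
  by (auto intro: carrier_matI)

lemma mat_adjoint_index [simp]:
  fixes A :: "complex mat"
  assumes "i < dim_col A" "j < dim_row A"
  shows "mat_adjoint A $$ (i, j) = cnj (A $$ (j, i))"
  using assms by (simp add: mat_adjoint_def mat_of_rows_def)

lemma mat_adjoint_adjoint [simp]: "mat_adjoint (mat_adjoint A) = (A :: complex mat)"
  by (rule eq_matI) simp_all

lemma eq_mat_on_vec:
  fixes A B :: "complex mat"
  assumes A: "A \<in> carrier_mat m n" and B: "B \<in> carrier_mat m n"
    and eq: "\<And>v. v \<in> carrier_vec n \<Longrightarrow> A *\<^sub>v v = B *\<^sub>v v"
  shows "A = B"
proof (rule eq_matI)
  fix i j assume ij: "i < dim_row B" "j < dim_col B"
  have "(A *\<^sub>v unit_vec n j) $ i = (B *\<^sub>v unit_vec n j) $ i" using eq by simp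
  thus "A $$ (i, j) = B $$ (i, j)" using ij A B by simp
qed (use A B in auto)

text \<open>\<open>P * Q\<close> and \<open>Q * P\<close> have the same trace, which is
  \<open>m\<close> for the one and \<open>n\<close> for the other.\<close>

lemma two_sided_inverse_dim:
  fixes P Q :: "complex mat"
  assumes P: "P \<in> carrier_mat m n" and Q: "Q \<in> carrier_mat n m"
    and PQ: "P * Q = 1\<^sub>m m" and QP: "Q * P = 1\<^sub>m n"
  shows "m = n"
proof -
  have "of_nat m = (\<Sum>i<m. (P * Q) $$ (i, i))" unfolding PQ by simp
  also have "\<dots> = (\<Sum>i<m. \<Sum>j<n. P $$ (i, j) * Q $$ (j, i))"
    using P Q by (simp add: scalar_prod_def lessThan_atLeast0)
  also have "\<dots> = (\<Sum>j<n. \<Sum>i<m. Q $$ (j, i) * P $$ (i, j))"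
    by (subst sum.swap) (simp add: mult.commute)
  also have "\<dots> = (\<Sum>j<n. (Q * P) $$ (j, j))"
    using P Q by (simp add: scalar_prod_def lessThan_atLeast0)
  also have "\<dots> = of_nat n" unfolding QP by simp
  finally have "(of_nat m :: complex) = of_nat n" .
  thus ?thesis by simp
qed

text \<open>The columns of \<open>Q\<close> are preimages of the unit vectors, which makes
  \<open>Q\<close> a right inverse. It is a left inverse because \<open>A\<close> kills
  \<open>Q *\<^sub>v (A *\<^sub>v v) - v\<close> and is injective.\<close>

lemma bijective_mat_inverse:
  fixes A :: "complex mat"
  assumes A: "A \<in> carrier_mat m n"
    and inj: "\<And>v. v \<in> carrier_vec n \<Longrightarrow> A *\<^sub>v v = 0\<^sub>v m \<Longrightarrow> v = 0\<^sub>v n"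
    and surj: "\<And>w. w \<in> carrier_vec m \<Longrightarrow> \<exists>v\<in>carrier_vec n. A *\<^sub>v v = w"
  shows "m = n \<and> (\<exists>Q\<in>carrier_mat n m. A * Q = 1\<^sub>m m \<and> Q * A = 1\<^sub>m n)"
proof -
  define q where "q i = (SOME v. v \<in> carrier_vec n \<and> A *\<^sub>v v = unit_vec m i)" for i
  have q: "q i \<in> carrier_vec n \<and> A *\<^sub>v q i = unit_vec m i" for i
    unfolding q_def by (rule someI_ex) (use surj[of "unit_vec m i"] in auto)
  define Q where "Q = mat n m (\<lambda>(j, i). q i $ j)"
  have Q: "Q \<in> carrier_mat n m" by (simp add: Q_def)
  have colQ: "col Q i = q i" if "i < m" for i
    using that q[of i] by (intro eq_vecI) (auto simp: Q_def)
  have AQ: "A * Q = 1\<^sub>m m"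
  proof (rule eq_matI)
    fix i j assume ij: "i < dim_row (1\<^sub>m m :: complex mat)" "j < dim_col (1\<^sub>m m :: complex mat)"
    have "(A * Q) $$ (i, j) = (A *\<^sub>v q j) $ i" using ij A Q colQ by simp
    thus "(A * Q) $$ (i, j) = 1\<^sub>m m $$ (i, j)" using q[of j] ij by simp
  qed (use A Q in auto)
  have QA: "Q * A = 1\<^sub>m n"
  proof (rule eq_mat_on_vec)
    fix v :: "complex vec" assume v: "v \<in> carrier_vec n"
    let ?d = "Q *\<^sub>v (A *\<^sub>v v) - v"
    have Av: "A *\<^sub>v v \<in> carrier_vec m" using A v by simp
    have QAv: "Q *\<^sub>v (A *\<^sub>v v) \<in> carrier_vec n" using Q Av by simp
    have "A *\<^sub>v ?d = A *\<^sub>v (Q *\<^sub>v (A *\<^sub>v v)) - A *\<^sub>v v"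
      by (rule mult_minus_distrib_mat_vec[OF A QAv v])
    also have "A *\<^sub>v (Q *\<^sub>v (A *\<^sub>v v)) = (A * Q) *\<^sub>v (A *\<^sub>v v)"
      by (rule assoc_mult_mat_vec[OF A Q Av, symmetric])
    also have "\<dots> = A *\<^sub>v v" using Av by (simp add: AQ)
    finally have "A *\<^sub>v ?d = 0\<^sub>v m" using Av by simp
    hence d: "?d = 0\<^sub>v n" using v QAv by (intro inj) auto
    have "Q *\<^sub>v (A *\<^sub>v v) = v"
    proof (rule eq_vecI)
      fix i assume i: "i < dim_vec v"
      have "?d $ i = 0" unfolding d using i v by simp
      thus "(Q *\<^sub>v (A *\<^sub>v v)) $ i = v $ i" using i v QAv by simp
    qed (use v Q in auto)
    thus "Q * A *\<^sub>v v = 1\<^sub>m n *\<^sub>v v" using assoc_mult_mat_vec[OF Q A v] v by simp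
  qed (use A Q in auto)
  show ?thesis using two_sided_inverse_dim[OF A Q AQ QA] Q AQ QA by blast
qed

section \<open>Equivalence of matrix representations\<close>

lemma equivalent_reps_sym:
  assumes "equivalent_reps G d \<sigma> d' \<tau>"
    and \<sigma>: "\<And>g. g \<in> G \<Longrightarrow> \<sigma> g \<in> carrier_mat d d" and \<tau>: "\<And>g. g \<in> G \<Longrightarrow> \<tau> g \<in> carrier_mat d' d'"
  shows "equivalent_reps G d' \<tau> d \<sigma>"
proof -
  obtain P Q where d: "d' = d" and P: "P \<in> carrier_mat d d" and Q: "Q \<in> carrier_mat d d"
    and PQ: "P * Q = 1\<^sub>m d" and QP: "Q * P = 1\<^sub>m d" and i: "\<And>g. g \<in> G \<Longrightarrow> P * \<sigma> g = \<tau> g * P"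
    using assms(1) by (auto simp: equivalent_reps_def)
  have "Q * \<tau> g = \<sigma> g * Q" if g: "g \<in> G" for g
  proof -
    note s = \<sigma>[OF g] and t = \<tau>[OF g, unfolded d]
    have "Q * \<tau> g = Q * \<tau> g * (P * Q)" using Q t by (simp add: PQ)
    also have "\<dots> = Q * (\<tau> g * P) * Q" using P Q t by (simp add: assoc_mult_mat[of _ d d _ d _ d])
    also have "\<dots> = (Q * P) * \<sigma> g * Q"
      using P Q s by (simp add: i[OF g, symmetric] assoc_mult_mat[of _ d d _ d _ d])
    finally show ?thesis using s by (simp add: QP)
  qed
  thus ?thesis using P Q PQ QP d by (auto simp: equivalent_reps_def)
qed

lemma equivalent_reps_trans:
  assumes "equivalent_reps G d \<sigma> d' \<tau>" "equivalent_reps G d' \<tau> d'' \<upsilon>"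
    and \<sigma>: "\<And>g. g \<in> G \<Longrightarrow> \<sigma> g \<in> carrier_mat d d" and \<tau>: "\<And>g. g \<in> G \<Longrightarrow> \<tau> g \<in> carrier_mat d' d'"
    and \<upsilon>: "\<And>g. g \<in> G \<Longrightarrow> \<upsilon> g \<in> carrier_mat d'' d''"
  shows "equivalent_reps G d \<sigma> d'' \<upsilon>"
proof -
  obtain P Q where d: "d' = d" and P: "P \<in> carrier_mat d d" and Q: "Q \<in> carrier_mat d d"
    and PQ: "P * Q = 1\<^sub>m d" and QP: "Q * P = 1\<^sub>m d" and i: "\<And>g. g \<in> G \<Longrightarrow> P * \<sigma> g = \<tau> g * P"
    using assms(1) by (auto simp: equivalent_reps_def)
  obtain P' Q' where d': "d'' = d" and P': "P' \<in> carrier_mat d d" and Q': "Q' \<in> carrier_mat d d"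
    and PQ': "P' * Q' = 1\<^sub>m d" and QP': "Q' * P' = 1\<^sub>m d" and i': "\<And>g. g \<in> G \<Longrightarrow> P' * \<tau> g = \<upsilon> g * P'"
    using assms(2) d by (auto simp: equivalent_reps_def)
  note assoc = assoc_mult_mat[of _ d d _ d _ d]
  have "P' * P * (Q * Q') = P' * (P * Q) * Q'" using P P' Q Q' by (simp add: assoc)
  hence 1: "P' * P * (Q * Q') = 1\<^sub>m d" using P' PQ PQ' by simp
  have "Q * Q' * (P' * P) = Q * (Q' * P') * P" using P P' Q Q' by (simp add: assoc)
  hence 2: "Q * Q' * (P' * P) = 1\<^sub>m d" using Q QP QP' by simp
  have 3: "P' * P * \<sigma> g = \<upsilon> g * (P' * P)" if g: "g \<in> G" for g
  proof -
    note s = \<sigma>[OF g] and t = \<tau>[OF g, unfolded d] and u = \<upsilon>[OF g, unfolded d']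
    have "P' * P * \<sigma> g = P' * (P * \<sigma> g)" using P P' s by (simp add: assoc)
    also have "\<dots> = (P' * \<tau> g) * P" using P P' t by (simp add: i[OF g] assoc)
    also have "\<dots> = \<upsilon> g * (P' * P)" using P P' u by (simp add: i'[OF g] assoc)
    finally show ?thesis .
  qed
  have 4: "P' * P \<in> carrier_mat d d" "Q * Q' \<in> carrier_mat d d" using P P' Q Q' by auto
  show ?thesis unfolding equivalent_reps_def d' using 1 2 3 4 by blast
qed

text \<open>Carries triviality at \<open>g\<close> from the members of a complete list to every
  irreducible representation.\<close>

lemma equivalent_reps_one:
  assumes "equivalent_reps G d \<sigma> d' \<tau>" "g \<in> G" "\<sigma> g \<in> carrier_mat d d" "\<tau> g = 1\<^sub>m d'"
  shows "\<sigma> g = 1\<^sub>m d"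
proof -
  obtain P Q where d: "d' = d" and P: "P \<in> carrier_mat d d" and Q: "Q \<in> carrier_mat d d"
    and PQ: "P * Q = 1\<^sub>m d" and QP: "Q * P = 1\<^sub>m d" and i: "P * \<sigma> g = \<tau> g * P"
    using assms(1,2) by (auto simp: equivalent_reps_def)
  have "\<sigma> g = Q * P * \<sigma> g" using assms(3) by (simp add: QP)
  also have "\<dots> = Q * (P * \<sigma> g)" by (rule assoc_mult_mat[OF Q P assms(3)])
  also have "\<dots> = 1\<^sub>m d" using P by (simp add: i assms(4) d QP)
  finally show ?thesis .
qed

section \<open>The regular representation\<close>

locale finite_subgroup = subgroup_of_semigroup G e gi
  for G :: "'a::semigroup_mult set" and e gi +
  assumes finite_G [simp]: "finite G"
begin

text \<open>The form is not divided by the order of \<open>G\<close>, so point masses are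
  orthonormal and the value of a function at a point is its inner product with a point mass.\<close>

definition hp :: "('a \<Rightarrow> complex) \<Rightarrow> ('a \<Rightarrow> complex) \<Rightarrow> complex" where
  "hp v w = (\<Sum>x\<in>G. v x * cnj (w x))"

text \<open>The regular representation by right translation, which is a left action without any
  inverse in the formula. The value 0 outside \<open>G\<close> makes equality of functions on the
  whole type agree with equality on \<open>G\<close>.\<close>

definition act :: "'a \<Rightarrow> ('a \<Rightarrow> complex) \<Rightarrow> 'a \<Rightarrow> complex" where
  "act g v = (\<lambda>x. if x \<in> G then v (x * g) else 0)"

definition submodule :: "('a \<Rightarrow> complex) set \<Rightarrow> bool" where
  "submodule W \<longleftrightarrow> (\<forall>v\<in>W. \<forall>x. x \<notin> G \<longrightarrow> v x = 0) \<and> (\<lambda>_. 0) \<in> W \<and>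
     (\<forall>v\<in>W. \<forall>w\<in>W. (\<lambda>x. v x + w x) \<in> W) \<and> (\<forall>c. \<forall>v\<in>W. (\<lambda>x. c * v x) \<in> W) \<and>
     (\<forall>g\<in>G. \<forall>v\<in>W. act g v \<in> W)"

definition simple_submodule :: "('a \<Rightarrow> complex) set \<Rightarrow> bool" where
  "simple_submodule W \<longleftrightarrow> submodule W \<and> W \<noteq> {\<lambda>_. 0} \<and>
     (\<forall>W'\<subseteq>W. submodule W' \<longrightarrow> W' = {\<lambda>_. 0} \<or> W' = W)"

definition orthonormal :: "nat \<Rightarrow> (nat \<Rightarrow> 'a \<Rightarrow> complex) \<Rightarrow> bool" where
  "orthonormal k b \<longleftrightarrow> (\<forall>i<k. \<forall>j<k. hp (b i) (b j) = (if i = j then 1 else 0))"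

definition comb :: "(nat \<Rightarrow> 'a \<Rightarrow> complex) \<Rightarrow> complex vec \<Rightarrow> 'a \<Rightarrow> complex" where
  "comb b c = (\<lambda>x. \<Sum>i<dim_vec c. c $ i * b i x)"

lemma hp_sum_left: "hp (\<lambda>x. \<Sum>i\<in>I. f i x) w = (\<Sum>i\<in>I. hp (f i) w)"
  unfolding hp_def sum_distrib_right by (rule sum.swap)

lemma hp_scale_left: "hp (\<lambda>x. c * v x) w = c * hp v w"
  by (simp add: hp_def sum_distrib_left mult.assoc)

lemma hp_diff_left: "hp (\<lambda>x. v x - u x) w = hp v w - hp u w"
  by (simp add: hp_def left_diff_distrib sum_subtractf)

lemma hp_cnj: "cnj (hp v w) = hp w v"
  by (simp add: hp_def mult.commute)

lemma hp_scale_right: "hp w (\<lambda>x. c * v x) = cnj c * hp w v"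
  by (simp add: hp_def sum_distrib_left mult_ac)

lemma hp_self: "hp v v = of_real (\<Sum>x\<in>G. (cmod (v x))\<^sup>2)"
  by (simp add: hp_def complex_norm_square[symmetric])

lemma hp_comb:
  assumes "orthonormal d b" "c \<in> carrier_vec d" "j < d"
  shows "hp (comb b c) (b j) = c $ j"
proof -
  have "hp (comb b c) (b j) = (\<Sum>i<d. c $ i * hp (b i) (b j))"
    using assms by (simp add: comb_def hp_sum_left hp_scale_left)
  also have "\<dots> = (\<Sum>i<d. if i = j then c $ i else 0)"
    using assms by (intro sum.cong) (auto simp: orthonormal_def)
  finally show ?thesis using assms(3) by simp
qed

text \<open>Bessel's inequality for the point masses, summed over all points.\<close>

lemma orthonormal_bound:
  assumes on: "orthonormal k b"
  shows "k \<le> card G"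
proof -
  define c where "c x = (\<Sum>i<k. (cmod (b i x))\<^sup>2)" for x
  have c_le: "c x \<le> 1" if x: "x \<in> G" for x
  proof -
    \<comment> \<open>These are the coefficients of the point mass at \<open>x\<close> along the
      \<open>b i\<close>, so \<open>w\<close> is the orthogonal projection of that point mass. Both
      \<open>w x\<close> and the squared norm of \<open>w\<close> equal \<open>c x\<close>, whence
      \<open>c x\<close> squared is at most \<open>c x\<close>.\<close>
    define a where "a = vec k (\<lambda>i. cnj (b i x))"
    define w where "w = comb b a"
    have a: "a \<in> carrier_vec k" by (simp add: a_def)
    have wx: "w x = of_real (c x)"
      by (simp add: w_def comb_def a_def c_def complex_norm_square[symmetric] mult.commute[of "cnj _"])
    have "hp w w = (\<Sum>i<k. a $ i * hp (b i) w)"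
      unfolding w_def by (subst comb_def) (simp add: hp_sum_left hp_scale_left a_def)
    also have "\<dots> = (\<Sum>i<k. a $ i * cnj (a $ i))"
    proof (rule sum.cong[OF refl])
      fix i assume "i \<in> {..<k}"
      thus "a $ i * hp (b i) w = a $ i * cnj (a $ i)"
        using hp_comb[OF on a, of i] hp_cnj[of w "b i"] by (simp add: w_def)
    qed
    also have "\<dots> = of_real (c x)"
      by (simp add: a_def c_def complex_norm_square[symmetric] mult.commute[of "cnj _"])
    finally have "(\<Sum>y\<in>G. (cmod (w y))\<^sup>2) = c x" unfolding hp_self of_real_eq_iff .
    moreover have "(cmod (w x))\<^sup>2 \<le> (\<Sum>y\<in>G. (cmod (w y))\<^sup>2)"
      by (rule member_le_sum[OF x]) auto
    ultimately have "(c x)\<^sup>2 \<le> c x" by (simp add: wx)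
    moreover have "0 \<le> c x" by (simp add: c_def sum_nonneg)
    ultimately show ?thesis
      by (cases "c x = 0") (auto simp: power2_eq_square)
  qed
  \<comment> \<open>Adding up the norms of the \<open>b i\<close> counts the family; exchanging the
    sums turns the total into a sum of \<open>c x\<close> over \<open>G\<close>.\<close>
  have "of_nat k = (\<Sum>i<k. hp (b i) (b i))" using on by (simp add: orthonormal_def)
  also have "\<dots> = of_real (\<Sum>i<k. \<Sum>x\<in>G. (cmod (b i x))\<^sup>2)" by (simp add: hp_self)
  also have "(\<Sum>i<k. \<Sum>x\<in>G. (cmod (b i x))\<^sup>2) = (\<Sum>x\<in>G. c x)"
    unfolding c_def by (rule sum.swap)
  finally have "of_real (of_nat k) = (of_real (\<Sum>x\<in>G. c x) :: complex)" by simp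
  hence "of_nat k = (\<Sum>x\<in>G. c x)" unfolding of_real_eq_iff .
  also have "\<dots> \<le> (\<Sum>x\<in>G. 1)" by (rule sum_mono) (rule c_le)
  finally show ?thesis by simp
qed

section \<open>Submodules and their dimension\<close>

lemma submoduleD:
  assumes "submodule W"
  shows "v \<in> W \<Longrightarrow> x \<notin> G \<Longrightarrow> v x = 0" "(\<lambda>_. 0) \<in> W"
    "v \<in> W \<Longrightarrow> w \<in> W \<Longrightarrow> (\<lambda>x. v x + w x) \<in> W" "v \<in> W \<Longrightarrow> (\<lambda>x. c * v x) \<in> W"
    "g \<in> G \<Longrightarrow> v \<in> W \<Longrightarrow> act g v \<in> W"
  using assms unfolding submodule_def by blast+

lemma submodule_sum:
  assumes "submodule W" "finite I" "\<And>i. i \<in> I \<Longrightarrow> f i \<in> W"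
  shows "(\<lambda>x. \<Sum>i\<in>I. f i x) \<in> W"
  using assms(2,3) by (induction I) (auto intro: submoduleD[OF assms(1)])

lemma submodule_comb:
  assumes "submodule W" "\<And>i. i < dim_vec c \<Longrightarrow> b i \<in> W"
  shows "comb b c \<in> W"
  unfolding comb_def using assms by (intro submodule_sum) (auto intro: submoduleD)

definition coords :: "nat \<Rightarrow> (nat \<Rightarrow> 'a \<Rightarrow> complex) \<Rightarrow> ('a \<Rightarrow> complex) \<Rightarrow> complex vec" where
  "coords d b v = vec d (\<lambda>i. hp v (b i))"

lemma coords_carrier [simp]: "coords d b v \<in> carrier_vec d" "dim_vec (coords d b v) = d"
  by (simp_all add: coords_def)

lemma coords_comb:
  assumes "orthonormal d b" "c \<in> carrier_vec d"
  shows "coords d b (comb b c) = c"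
  using assms by (intro eq_vecI) (auto simp: coords_def hp_comb)

text \<open>One Gram-Schmidt step: the difference between \<open>v\<close> and its projection is
  orthogonal to the family, nonzero, and can be normalised.\<close>

lemma orthonormal_extend:
  assumes W: "submodule W" and on: "orthonormal k b" and bW: "\<And>i. i < k \<Longrightarrow> b i \<in> W"
    and v: "v \<in> W" "comb b (coords k b v) \<noteq> v"
  shows "\<exists>b'. orthonormal (Suc k) b' \<and> (\<forall>i<Suc k. b' i \<in> W)"
proof -
  let ?p = "comb b (coords k b v)"
  define u where "u = (\<lambda>x. v x - ?p x)"
  have pW: "?p \<in> W" using W bW by (intro submodule_comb) auto
  have "(\<lambda>x. v x + (- 1) * ?p x) \<in> W"
    by (intro submoduleD(3)[OF W] submoduleD(4)[OF W] v pW)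
  hence uW: "u \<in> W" by (simp add: u_def)
  have ub: "hp u (b j) = 0" if "j < k" for j
    using that unfolding u_def hp_diff_left
    by (subst hp_comb[OF on]) (auto simp: coords_def)
  define r where "r = (\<Sum>x\<in>G. (cmod (u x))\<^sup>2)"
  obtain x where "?p x \<noteq> v x" using v(2) by blast
  hence x: "u x \<noteq> 0" by (simp add: u_def)
  hence "x \<in> G" using submoduleD(1)[OF W uW] by auto
  hence "r > 0" unfolding r_def using x by (intro sum_pos2[of _ x]) auto
  define w where "w = (\<lambda>x. of_real (1 / sqrt r) * u x)"
  have ww: "hp w w = 1"
    using \<open>r > 0\<close> unfolding w_def hp_scale_left hp_scale_right hp_self r_def[symmetric]
    by (simp add: of_real_mult[symmetric] del: of_real_mult of_real_divide)
  have wb: "hp w (b j) = 0" if "j < k" for j unfolding w_def hp_scale_left using ub[OF that] by simp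
  have bw: "hp (b j) w = 0" if "j < k" for j using wb[OF that] hp_cnj[of w "b j"] by simp
  have "w \<in> W" unfolding w_def by (rule submoduleD(4)[OF W uW])
  moreover have "orthonormal (Suc k) (b(k := w))"
    using on ww wb bw by (auto simp: orthonormal_def less_Suc_eq)
  ultimately show ?thesis using bW by (intro exI[of _ "b(k := w)"]) (auto simp: less_Suc_eq)
qed

text \<open>The dimension of a submodule, measured by orthonormal families. The maximum exists
  because the empty family qualifies and \<open>orthonormal_bound\<close> limits the length.\<close>

definition odim :: "('a \<Rightarrow> complex) set \<Rightarrow> nat" where
  "odim W = (GREATEST k. \<exists>b. orthonormal k b \<and> (\<forall>i<k. b i \<in> W))"

lemma odim_basis: "\<exists>b. orthonormal (odim W) b \<and> (\<forall>i<odim W. b i \<in> W)"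
  unfolding odim_def
  by (rule GreatestI_ex_nat[where b = "card G"])
     (auto intro: orthonormal_bound exI[of _ 0] simp: orthonormal_def)

lemma odim_max:
  assumes "orthonormal k b" "\<And>i. i < k \<Longrightarrow> b i \<in> W"
  shows "k \<le> odim W"
  unfolding odim_def
  by (rule Greatest_le_nat[where b = "card G"]) (use assms orthonormal_bound in auto)

text \<open>An orthonormal family of maximal length spans, since otherwise
  \<open>orthonormal_extend\<close> would lengthen it.\<close>

lemma comb_coords:
  assumes "submodule W" "orthonormal (odim W) b" "\<And>i. i < odim W \<Longrightarrow> b i \<in> W" "v \<in> W"
  shows "comb b (coords (odim W) b v) = v"
proof (rule ccontr)
  assume "comb b (coords (odim W) b v) \<noteq> v"
  then obtain b' where "orthonormal (Suc (odim W)) b'" "\<forall>i<Suc (odim W). b' i \<in> W"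
    using orthonormal_extend[OF assms] by blast
  hence "Suc (odim W) \<le> odim W" by (intro odim_max) auto
  thus False by simp
qed

text \<open>A nonzero submodule of least dimension is simple: a nonzero submodule inside it has the
  same dimension, so an orthonormal basis of the smaller one is also one of the larger.\<close>

lemma simple_submodule_exists:
  assumes U: "submodule U" "U \<noteq> {\<lambda>_. 0}"
  obtains W where "W \<subseteq> U" "simple_submodule W"
proof -
  let ?P = "\<lambda>W. submodule W \<and> W \<subseteq> U \<and> W \<noteq> {\<lambda>_. 0}"
  obtain W where W: "?P W" and least: "\<And>W'. ?P W' \<Longrightarrow> odim W \<le> odim W'"
    using ex_has_least_nat[of ?P U odim] U by blast
  have "W' = W" if W': "W' \<subseteq> W" "submodule W'" "W' \<noteq> {\<lambda>_. 0}" for W'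
  proof
    obtain b where b: "orthonormal (odim W') b" "\<And>i. i < odim W' \<Longrightarrow> b i \<in> W'"
      using odim_basis by blast
    have "odim W' \<le> odim W" using b W'(1) by (intro odim_max) auto
    moreover have "odim W \<le> odim W'" using least W' W by blast
    ultimately have eq: "odim W' = odim W" by simp
    show "W \<subseteq> W'"
    proof
      fix v assume v: "v \<in> W"
      have "comb b (coords (odim W) b v) = v"
        using W b W'(1) v eq by (intro comb_coords) auto
      moreover have "comb b (coords (odim W) b v) \<in> W'"
        using W'(2) b eq by (intro submodule_comb) auto
      ultimately show "v \<in> W'" by simp
    qed
  qed (use W' in blast)
  hence "simple_submodule W" using W unfolding simple_submodule_def by blast
  thus thesis using W that by blast
qed

section \<open>Unitary representations on simple submodules\<close>

lemma act_act:
  assumes "g \<in> G" "h \<in> G"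
  shows "act g (act h v) = act (g * h) v"
  using assms by (auto simp: act_def mult.assoc)

lemma act_e:
  assumes "\<And>x. x \<notin> G \<Longrightarrow> v x = 0"
  shows "act e v = v"
  using assms by (auto simp: act_def)

lemma hp_act:
  assumes g: "g \<in> G"
  shows "hp (act g v) (act g w) = hp v w"
proof -
  have "hp (act g v) (act g w) = (\<Sum>x\<in>G. v (x * g) * cnj (w (x * g)))"
    by (simp add: hp_def act_def)
  also have "\<dots> = hp v w" unfolding hp_def
    by (rule sum.reindex_bij_betw[OF bij_betw_right_mult[OF g], of "\<lambda>x. v x * cnj (w x)"])
  finally show ?thesis .
qed

definition unitary_irrep :: "nat \<Rightarrow> ('a \<Rightarrow> complex mat) \<Rightarrow> bool" where
  "unitary_irrep d \<tau> \<longleftrightarrow>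
     irreducible_rep G e d \<tau> \<and> (\<forall>g\<in>G. \<tau> (gi g) = mat_adjoint (\<tau> g))"

text \<open>The matrices of the action in an orthonormal basis are unitary because translation
  preserves the form. \<open>comb b\<close> turns invariant subspaces of coordinate vectors into
  submodules of \<open>W\<close>, which gives irreducibility. The basis \<open>b\<close> is returned
  as well, so that functions and coordinates can be exchanged later.\<close>

lemma simple_submodule_irrep:
  assumes W: "simple_submodule W"
  obtains d \<tau> b where "unitary_irrep d \<tau>" "orthonormal d b" "\<forall>i<d. b i \<in> W"
    "\<forall>v\<in>W. comb b (coords d b v) = v"
    "\<forall>g\<in>G. \<forall>c\<in>carrier_vec d. act g (comb b c) = comb b (\<tau> g *\<^sub>v c)"
proof -
  define d where "d = odim W"
  have sub: "submodule W" using W by (simp add: simple_submodule_def)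
  obtain b where on: "orthonormal d b" and bW: "\<And>i. i < d \<Longrightarrow> b i \<in> W"
    using odim_basis unfolding d_def by blast
  have exp: "comb b (coords d b v) = v" if "v \<in> W" for v
    using comb_coords[OF sub] on bW that unfolding d_def by blast
  define \<tau> where "\<tau> g = mat d d (\<lambda>(i, j). hp (act g (b j)) (b i))" for g
  have \<tau>: "\<tau> g \<in> carrier_mat d d" for g by (simp add: \<tau>_def)
  have combW: "comb b c \<in> W" if "c \<in> carrier_vec d" for c
    using that bW by (intro submodule_comb[OF sub]) auto
  have act_comb: "act g (comb b c) = comb b (\<tau> g *\<^sub>v c)" if g: "g \<in> G" and c: "c \<in> carrier_vec d" for g c
  proof
    fix x
    show "act g (comb b c) x = comb b (\<tau> g *\<^sub>v c) x"
    proof (cases "x \<in> G")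
      case False
      have "comb b (\<tau> g *\<^sub>v c) \<in> W" using mult_mat_vec_carrier[OF \<tau> c] by (rule combW)
      hence "comb b (\<tau> g *\<^sub>v c) x = 0" using submoduleD(1)[OF sub] False by blast
      thus ?thesis using False by (simp add: act_def)
    next
      case True
      have e1: "b j (x * g) = (\<Sum>i<d. hp (act g (b j)) (b i) * b i x)" if "j < d" for j
      proof -
        have "act g (b j) \<in> W" using g that bW by (intro submoduleD(5)[OF sub]) auto
        hence "act g (b j) x = comb b (coords d b (act g (b j))) x" by (simp add: exp)
        thus ?thesis using True by (simp add: act_def comb_def coords_def)
      qed
      have "act g (comb b c) x = (\<Sum>j<d. c $ j * b j (x * g))"
        using True c by (simp add: act_def comb_def)
      also have "\<dots> = (\<Sum>j<d. \<Sum>i<d. c $ j * (hp (act g (b j)) (b i) * b i x))"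
        by (simp add: e1 sum_distrib_left)
      also have "\<dots> = (\<Sum>i<d. \<Sum>j<d. c $ j * (hp (act g (b j)) (b i) * b i x))"
        by (rule sum.swap)
      also have "\<dots> = (\<Sum>i<d. (\<tau> g *\<^sub>v c) $ i * b i x)"
        using c by (intro sum.cong) (auto simp: \<tau>_def scalar_prod_def sum_distrib_left
            lessThan_atLeast0 mult_ac intro!: sum.cong)
      also have "\<dots> = comb b (\<tau> g *\<^sub>v c) x" using \<tau>[of g] by (simp add: comb_def)
      finally show ?thesis .
    qed
  qed
  have inj: "c = c'" if "comb b c = comb b c'" "c \<in> carrier_vec d" "c' \<in> carrier_vec d" for c c'
    using that coords_comb[OF on] by metis
  have rep: "group_matrix_rep G e d \<tau>"
    unfolding group_matrix_rep_def
  proof (intro conjI ballI)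
    show "\<tau> e = 1\<^sub>m d"
    proof (rule eq_mat_on_vec[OF \<tau>])
      fix c :: "complex vec" assume c: "c \<in> carrier_vec d"
      have "comb b (\<tau> e *\<^sub>v c) = act e (comb b c)" by (simp add: act_comb c)
      also have "\<dots> = comb b c"
        by (rule act_e) (use submoduleD(1)[OF sub combW[OF c]] in auto)
      finally show "\<tau> e *\<^sub>v c = 1\<^sub>m d *\<^sub>v c" using inj c \<tau>[of e] by simp
    qed simp
    fix g h assume g: "g \<in> G" and h: "h \<in> G"
    show "\<tau> (g * h) = \<tau> g * \<tau> h"
    proof (rule eq_mat_on_vec[OF \<tau>])
      show "\<tau> g * \<tau> h \<in> carrier_mat d d" using \<tau> by (rule mult_carrier_mat) (rule \<tau>)
      fix c :: "complex vec" assume c: "c \<in> carrier_vec d"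
      note hc = mult_mat_vec_carrier[OF \<tau>[of h] c]
      have "comb b (\<tau> (g * h) *\<^sub>v c) = act g (act h (comb b c))"
        unfolding act_act[OF g h] by (rule act_comb[symmetric]) (use g h c in auto)
      also have "\<dots> = comb b (\<tau> g *\<^sub>v (\<tau> h *\<^sub>v c))"
        unfolding act_comb[OF h c] by (rule act_comb[OF g hc])
      finally have "\<tau> (g * h) *\<^sub>v c = \<tau> g *\<^sub>v (\<tau> h *\<^sub>v c)"
        by (rule inj) (use \<tau> hc c in \<open>auto intro: mult_mat_vec_carrier\<close>)
      thus "\<tau> (g * h) *\<^sub>v c = \<tau> g * \<tau> h *\<^sub>v c"
        using assoc_mult_mat_vec[OF \<tau> \<tau> c] by simp
    qed
  qed (rule \<tau>)
  have "d > 0"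
  proof (rule ccontr)
    assume "\<not> d > 0"
    hence "v = (\<lambda>_. 0)" if "v \<in> W" for v using exp[OF that] by (simp add: comb_def fun_eq_iff)
    moreover have "(\<lambda>_. 0) \<in> W" by (rule submoduleD(2)[OF sub])
    ultimately have "W = {\<lambda>_. 0}" by blast
    thus False using W by (simp add: simple_submodule_def)
  qed
  have comb_add: "comb b (c + c') = (\<lambda>x. comb b c x + comb b c' x)"
    if "c \<in> carrier_vec d" "c' \<in> carrier_vec d" for c c'
    using that by (auto simp: comb_def distrib_right sum.distrib)
  have comb_smult: "comb b (a \<cdot>\<^sub>v c) = (\<lambda>x. a * comb b c x)"
    if "c \<in> carrier_vec d" for a c
    using that by (auto simp: comb_def sum_distrib_left mult.assoc)
  have comb_0: "comb b (0\<^sub>v d) = (\<lambda>_. 0)" by (simp add: comb_def)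
  have irr: "U = {0\<^sub>v d} \<or> U = carrier_vec d" if U: "invariant_subspace G d \<tau> U" for U
  proof -
    have Uc: "U \<subseteq> carrier_vec d" and U0: "0\<^sub>v d \<in> U" using U by (auto simp: invariant_subspace_def)
    have subU: "submodule (comb b ` U)"
      unfolding submodule_def
    proof (intro conjI ballI allI impI)
      fix v x assume "v \<in> comb b ` U" "x \<notin> G"
      thus "v x = 0" using submoduleD(1)[OF sub] combW Uc by blast
    next
      show "(\<lambda>_. 0) \<in> comb b ` U" using U0 comb_0 by (metis imageI)
    next
      fix v w assume "v \<in> comb b ` U" "w \<in> comb b ` U"
      then obtain c c' where c: "c \<in> U" "c' \<in> U" "v = comb b c" "w = comb b c'" by blast
      hence "c + c' \<in> U" using U by (auto simp: invariant_subspace_def)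
      moreover have "(\<lambda>x. v x + w x) = comb b (c + c')" using comb_add[of c c'] subsetD[OF Uc] c by simp
      ultimately show "(\<lambda>x. v x + w x) \<in> comb b ` U" by blast
    next
      fix a v assume "v \<in> comb b ` U"
      then obtain c where c: "c \<in> U" "v = comb b c" by blast
      hence "a \<cdot>\<^sub>v c \<in> U" using U by (auto simp: invariant_subspace_def)
      moreover have "(\<lambda>x. a * v x) = comb b (a \<cdot>\<^sub>v c)" using comb_smult[of c a] subsetD[OF Uc] c by simp
      ultimately show "(\<lambda>x. a * v x) \<in> comb b ` U" by blast
    next
      fix g v assume g: "g \<in> G" and "v \<in> comb b ` U"
      then obtain c where c: "c \<in> U" "v = comb b c" by blast
      hence "\<tau> g *\<^sub>v c \<in> U" using U g by (auto simp: invariant_subspace_def)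
      moreover have "act g v = comb b (\<tau> g *\<^sub>v c)" using act_comb[OF g, of c] subsetD[OF Uc] c by simp
      ultimately show "act g v \<in> comb b ` U" by blast
    qed
    have "comb b ` U \<subseteq> W" using combW Uc by blast
    hence "comb b ` U = {\<lambda>_. 0} \<or> comb b ` U = W"
      using W subU by (simp add: simple_submodule_def)
    thus ?thesis
    proof
      assume z: "comb b ` U = {\<lambda>_. 0}"
      have "c = 0\<^sub>v d" if "c \<in> U" for c
        using z comb_0 that Uc by (intro inj) auto
      thus ?thesis using U0 by blast
    next
      assume w: "comb b ` U = W"
      have "c \<in> U" if c: "c \<in> carrier_vec d" for c
      proof -
        have "comb b c \<in> comb b ` U" using combW[OF c] by (simp add: w)
        then obtain c' where c': "comb b c = comb b c'" "c' \<in> U" by (rule imageE)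
        have "c = c'" by (rule inj[OF c'(1) c subsetD[OF Uc c'(2)]])
        thus ?thesis using c'(2) by simp
      qed
      thus ?thesis using Uc by blast
    qed
  qed
  have "\<tau> (gi g) = mat_adjoint (\<tau> g)" if g: "g \<in> G" for g
  proof (rule eq_matI)
    fix i j assume "i < dim_row (mat_adjoint (\<tau> g))" "j < dim_col (mat_adjoint (\<tau> g))"
    hence ij: "i < d" "j < d" using \<tau>[of g] by auto
    have "act g (act (gi g) (b j)) = b j"
      using g act_e[of "b j"] submoduleD(1)[OF sub bW[OF ij(2)]] by (simp add: act_act)
    hence "hp (act (gi g) (b j)) (b i) = hp (b j) (act g (b i))"
      using hp_act[OF g, of "act (gi g) (b j)" "b i"] by simp
    thus "\<tau> (gi g) $$ (i, j) = mat_adjoint (\<tau> g) $$ (i, j)"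
      using ij \<tau>[of g] by (simp add: hp_cnj \<tau>_def)
  qed (auto simp: \<tau>_def)
  hence u: "unitary_irrep d \<tau>"
    using rep irr \<open>d > 0\<close> by (simp add: unitary_irrep_def irreducible_rep_def)
  show thesis by (rule that[OF u on]) (auto simp: bW exp act_comb)
qed

section \<open>Irreducible representations separate points\<close>

lemma submodule_full: "submodule {v. \<forall>x. x \<notin> G \<longrightarrow> v x = 0}"
  by (auto simp: submodule_def act_def)

text \<open>Ensures that a complete list is not empty and hence that \<open>rep_dim\<close> is
  positive. The point mass at \<open>e\<close> shows that the module of all functions is
  nonzero.\<close>

lemma unitary_irrep_exists: "\<exists>d \<tau>. unitary_irrep d \<tau>"
proof -
  have "(\<lambda>x. if x = e then 1 else 0) \<in> {v. \<forall>x. x \<notin> G \<longrightarrow> v x = (0::complex)}" by auto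
  moreover have "(\<lambda>x. if x = e then 1 else 0) \<noteq> (\<lambda>_. 0::complex)" by (auto simp: fun_eq_iff)
  ultimately have "{v. \<forall>x. x \<notin> G \<longrightarrow> v x = (0::complex)} \<noteq> {\<lambda>_. 0}" by blast
  then obtain W where "simple_submodule W" using simple_submodule_exists[OF submodule_full] by metis
  thus ?thesis by (rule simple_submodule_irrep) blast
qed

text \<open>The averaging operator of the common kernel \<open>N\<close> of all irreducible representations has
  trivial kernel on the regular representation, since \<open>N\<close> would fix a simple submodule
  of that kernel pointwise.\<close>

lemma irreps_separate:
  assumes n: "n \<in> G" and triv: "\<And>d \<tau>. irreducible_rep G e d \<tau> \<Longrightarrow> \<tau> n = 1\<^sub>m d"
  shows "n = e"
proof -
  define N where "N = {m\<in>G. \<forall>d \<tau>. irreducible_rep G e d \<tau> \<longrightarrow> \<tau> m = 1\<^sub>m d}"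
  have rep: "\<tau> e = 1\<^sub>m d \<and> (\<forall>g\<in>G. \<tau> g \<in> carrier_mat d d) \<and> (\<forall>g\<in>G. \<forall>h\<in>G. \<tau> (g * h) = \<tau> g * \<tau> h)"
    if "irreducible_rep G e d \<tau>" for d \<tau>
    using that by (auto simp: irreducible_rep_def group_matrix_rep_def)
  have Ntriv: "\<tau> m = 1\<^sub>m d" if "m \<in> N" "irreducible_rep G e d \<tau>" for m d \<tau>
    using that unfolding N_def by blast
  have NG: "m \<in> G" if "m \<in> N" for m using that by (simp add: N_def)
  have finN: "finite N" by (rule finite_subset[of _ G]) (auto simp: N_def)
  have nN: "n \<in> N" using n triv by (simp add: N_def)
  have eN: "e \<in> N" using rep by (simp add: N_def)
  have mN: "m * k \<in> N" if "m \<in> N" "k \<in> N" for m k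
  proof -
    have "\<tau> (m * k) = 1\<^sub>m d" if t: "irreducible_rep G e d \<tau>" for d \<tau>
    proof -
      have "\<tau> m = 1\<^sub>m d" "\<tau> k = 1\<^sub>m d" using Ntriv t \<open>m \<in> N\<close> \<open>k \<in> N\<close> by blast+
      thus ?thesis using rep[OF t] NG \<open>m \<in> N\<close> \<open>k \<in> N\<close> by simp
    qed
    thus ?thesis using NG that by (simp add: N_def)
  qed
  have iN: "gi m \<in> N" if m: "m \<in> N" for m
  proof -
    have "\<tau> (gi m) = 1\<^sub>m d" if t: "irreducible_rep G e d \<tau>" for d \<tau>
    proof -
      have "\<tau> (gi m * m) = \<tau> (gi m) * \<tau> m" using rep[OF t] NG[OF m] gi_in[OF NG[OF m]] by blast
      moreover have "\<tau> m = 1\<^sub>m d" by (rule Ntriv[OF m t])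
      moreover have "\<tau> (gi m) \<in> carrier_mat d d" using rep[OF t] NG[OF m] by simp
      ultimately show ?thesis using rep[OF t] NG[OF m] by simp
    qed
    thus ?thesis using NG[OF m] by (simp add: N_def)
  qed
  have cN: "gi g * m * g \<in> N" if g: "g \<in> G" and m: "m \<in> N" for g m
  proof -
    have "\<tau> (gi g * m * g) = 1\<^sub>m d" if t: "irreducible_rep G e d \<tau>" for d \<tau>
    proof -
      have c: "\<tau> (gi g) \<in> carrier_mat d d" using rep[OF t] g by simp
      have "\<tau> (gi g * m * g) = \<tau> (gi g) * \<tau> m * \<tau> g" using rep[OF t] NG[OF m] g by simp
      also have "\<tau> m = 1\<^sub>m d" by (rule Ntriv[OF m t])
      also have "\<tau> (gi g) * 1\<^sub>m d * \<tau> g = \<tau> (gi g) * \<tau> g" using c by simp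
      also have "\<dots> = \<tau> (gi g * g)" using rep[OF t] g gi_in[OF g] by metis
      also have "\<dots> = 1\<^sub>m d" using rep[OF t] g by simp
      finally show ?thesis .
    qed
    thus ?thesis using NG[OF m] g by (simp add: N_def)
  qed
  define K where "K = {v. (\<forall>x. x \<notin> G \<longrightarrow> v x = 0) \<and> (\<forall>x\<in>G. (\<Sum>m\<in>N. v (x * m)) = (0::complex))}"
  have subK: "submodule K"
    unfolding submodule_def
  proof (intro conjI ballI allI impI)
    fix g v assume g: "g \<in> G" and v: "v \<in> K"
    have "(\<Sum>m\<in>N. act g v (x * m)) = 0" if x: "x \<in> G" for x
    proof -
      \<comment> \<open>Normality of \<open>N\<close> lets \<open>g\<close> pass through the
        average: \<open>x * m * g\<close> is \<open>x * g\<close> times the conjugate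
        \<open>gi g * m * g\<close>.\<close>
      have bij: "bij_betw (\<lambda>m. gi g * m * g) N N"
      proof (rule bij_betw_byWitness[where f' = "\<lambda>m. gi (gi g) * m * gi g"])
        show "\<forall>a\<in>N. gi (gi g) * (gi g * a * g) * gi g = a" using g NG by (simp add: mult.assoc)
        show "\<forall>a'\<in>N. gi g * (gi (gi g) * a' * gi g) * g = a'" using g NG by (simp add: mult.assoc)
      qed (use cN[OF g] cN[OF gi_in[OF g]] in auto)
      have "(\<Sum>m\<in>N. act g v (x * m)) = (\<Sum>m\<in>N. v ((x * g) * (gi g * m * g)))"
        using x g NG by (intro sum.cong) (auto simp: act_def mult.assoc)
      also have "\<dots> = (\<Sum>m\<in>N. v ((x * g) * m))"
        by (rule sum.reindex_bij_betw[OF bij])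
      also have "\<dots> = 0" using v x g by (simp add: K_def)
      finally show ?thesis .
    qed
    thus "act g v \<in> K" by (simp add: K_def act_def)
  qed (auto simp: K_def sum.distrib sum_distrib_left[symmetric])
  \<comment> \<open>On a function fixed by \<open>N\<close> the sum over \<open>N\<close> is
    \<open>card N\<close> times the function. Membership in \<open>K\<close> therefore forces the
    basis vector \<open>b 0\<close> to vanish, although its norm is 1.\<close>
  have K0: "K = {\<lambda>_. 0}"
  proof (rule ccontr)
    assume "K \<noteq> {\<lambda>_. 0}"
    then obtain W where WK: "W \<subseteq> K" and W: "simple_submodule W"
      using simple_submodule_exists[OF subK] by metis
    obtain d \<tau> b where t: "unitary_irrep d \<tau>" and on: "orthonormal d b"
      and bW: "\<forall>i<d. b i \<in> W" and ex: "\<forall>v\<in>W. comb b (coords d b v) = v"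
      and ac: "\<forall>g\<in>G. \<forall>c\<in>carrier_vec d. act g (comb b c) = comb b (\<tau> g *\<^sub>v c)"
      by (rule simple_submodule_irrep[OF W])
    have irr: "irreducible_rep G e d \<tau>" and d: "d > 0"
      using t by (auto simp: unitary_irrep_def irreducible_rep_def)
    have fixed: "act m v = v" if m: "m \<in> N" and v: "v \<in> W" for m v
    proof -
      have "act m (comb b (coords d b v)) = comb b (\<tau> m *\<^sub>v coords d b v)"
        using NG[OF m] ac by simp
      thus ?thesis using Ntriv[OF m irr] bspec[OF ex v] by simp
    qed
    have b0: "b 0 \<in> W" using bW d by simp
    have "b 0 x = 0" for x
    proof (cases "x \<in> G")
      case True
      have "b 0 (x * m) = b 0 x" if "m \<in> N" for m
        using fun_cong[OF fixed[OF that b0], of x] True by (simp add: act_def)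
      hence "(\<Sum>m\<in>N. b 0 (x * m)) = of_nat (card N) * b 0 x" by simp
      moreover have "(\<Sum>m\<in>N. b 0 (x * m)) = 0" using subsetD[OF WK b0] True by (simp add: K_def)
      ultimately show ?thesis using finN eN by auto
    qed (use subsetD[OF WK b0] in \<open>simp add: K_def\<close>)
    hence "hp (b 0) (b 0) = 0" by (simp add: hp_def)
    thus False using on d by (simp add: orthonormal_def)
  qed
  \<comment> \<open>The translate of the point mass by \<open>n\<close> has the same sums over the
    cosets of \<open>N\<close> as the point mass itself, so their difference lies in
    \<open>K\<close> and is zero. Its value at \<open>e\<close> compares \<open>n\<close> with
    \<open>e\<close>.\<close>
  define \<delta> where "\<delta> = (\<lambda>x. if x = e then 1 else (0::complex))"
  define w where "w = (\<lambda>x. act n \<delta> x - \<delta> x)"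
  have "w \<in> K" unfolding K_def
  proof (intro CollectI conjI allI impI ballI)
    fix x assume "x \<notin> G" thus "w x = 0" by (auto simp: w_def act_def \<delta>_def)
  next
    fix x assume x: "x \<in> G"
    have bij: "bij_betw (\<lambda>m. m * n) N N"
      by (rule bij_betw_byWitness[where f' = "\<lambda>m. m * gi n"])
         (use mN nN iN NG n in \<open>auto simp: mult.assoc\<close>)
    have "(\<Sum>m\<in>N. w (x * m)) = (\<Sum>m\<in>N. \<delta> (x * (m * n))) - (\<Sum>m\<in>N. \<delta> (x * m))"
      using x NG by (simp add: w_def act_def sum_subtractf mult.assoc)
    also have "(\<Sum>m\<in>N. \<delta> (x * (m * n))) = (\<Sum>m\<in>N. \<delta> (x * m))"
      by (rule sum.reindex_bij_betw[OF bij])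
    finally show "(\<Sum>m\<in>N. w (x * m)) = 0" by simp
  qed
  hence "w e = 0" by (simp add: K0)
  thus ?thesis using n by (auto simp: w_def act_def \<delta>_def split: if_splits)
qed

section \<open>Every irreducible representation is equivalent to a unitary one\<close>

lemma group_matrix_rep_entry:
  assumes "group_matrix_rep G e d \<sigma>" "g \<in> G" "h \<in> G" "i < d" "j < d"
  shows "\<sigma> (g * h) $$ (i, j) = (\<Sum>k<d. \<sigma> g $$ (i, k) * \<sigma> h $$ (k, j))"
proof -
  have "\<sigma> g \<in> carrier_mat d d" "\<sigma> h \<in> carrier_mat d d" "\<sigma> (g * h) = \<sigma> g * \<sigma> h"
    using assms by (auto simp: group_matrix_rep_def)
  thus ?thesis using assms by (simp add: scalar_prod_def lessThan_atLeast0)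
qed

text \<open>The map \<open>w \<mapsto> (x \<mapsto> (\<sigma>(x) w)\<^sub>0)\<close> embeds an irreducible representation into the regular one,
  where the action is unitary.\<close>

lemma irrep_equivalent_unitary:
  assumes irr: "irreducible_rep G e d \<sigma>"
  obtains d' \<tau> where "unitary_irrep d' \<tau>" "equivalent_reps G d \<sigma> d' \<tau>"
proof -
  have d: "d > 0" and rep: "group_matrix_rep G e d \<sigma>" using irr by (auto simp: irreducible_rep_def)
  have \<sigma>: "\<sigma> g \<in> carrier_mat d d" if "g \<in> G" for g using rep that by (simp add: group_matrix_rep_def)
  have \<sigma>e: "\<sigma> e = 1\<^sub>m d" using rep by (simp add: group_matrix_rep_def)
  have \<sigma>m: "\<sigma> (g * h) = \<sigma> g * \<sigma> h" if "g \<in> G" "h \<in> G" for g h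
    using rep that by (simp add: group_matrix_rep_def)
  define T where "T w = (\<lambda>x. if x \<in> G then (\<sigma> x *\<^sub>v w) $ 0 else 0)" for w
  have T0: "T (0\<^sub>v d) = (\<lambda>_. 0)" 
  proof
    fix x show "T (0\<^sub>v d) x = 0" using \<sigma>[of x] d by (auto simp: T_def)
  qed
  have Tadd: "T (v + w) = (\<lambda>x. T v x + T w x)" if "v \<in> carrier_vec d" "w \<in> carrier_vec d" for v w
  proof
    fix x show "T (v + w) x = T v x + T w x"
      using \<sigma>[of x] d that by (auto simp: T_def mult_add_distrib_mat_vec[of "\<sigma> x" d d])
  qed
  have Tsm: "T (c \<cdot>\<^sub>v v) = (\<lambda>x. c * T v x)" if "v \<in> carrier_vec d" for c v
  proof
    fix x show "T (c \<cdot>\<^sub>v v) x = c * T v x"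
      using \<sigma>[of x] d that by (auto simp: T_def mult_mat_vec[of "\<sigma> x" d d])
  qed
  have Tact: "T (\<sigma> g *\<^sub>v v) = act g (T v)" if g: "g \<in> G" and v: "v \<in> carrier_vec d" for g v
    using g assoc_mult_mat_vec[OF \<sigma> \<sigma>[OF g] v] by (auto simp: T_def act_def fun_eq_iff \<sigma>m)
  define W where "W = T ` carrier_vec d"
  have sub: "submodule W"
    unfolding submodule_def
  proof (intro conjI ballI allI impI)
    fix v x assume "v \<in> W" "x \<notin> G" thus "v x = 0" by (auto simp: W_def T_def)
  next
    show "(\<lambda>_. 0) \<in> W" unfolding W_def by (rule image_eqI[of _ _ "0\<^sub>v d"]) (simp_all add: T0)
  next
    fix v w assume "v \<in> W" "w \<in> W"
    then obtain a b where "a \<in> carrier_vec d" "b \<in> carrier_vec d" "v = T a" "w = T b" by (auto simp: W_def)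
    thus "(\<lambda>x. v x + w x) \<in> W" unfolding W_def by (intro image_eqI[of _ _ "a + b"]) (auto simp: Tadd)
  next
    fix c v assume "v \<in> W"
    then obtain a where "a \<in> carrier_vec d" "v = T a" by (auto simp: W_def)
    thus "(\<lambda>x. c * v x) \<in> W" unfolding W_def by (intro image_eqI[of _ _ "c \<cdot>\<^sub>v a"]) (auto simp: Tsm)
  next
    fix g v assume g: "g \<in> G" and "v \<in> W"
    then obtain a where "a \<in> carrier_vec d" "v = T a" by (auto simp: W_def)
    thus "act g v \<in> W" unfolding W_def using g mult_mat_vec_carrier[OF \<sigma>[OF g]]
      by (intro image_eqI[of _ _ "\<sigma> g *\<^sub>v a"]) (auto simp: Tact)
  qed
  \<comment> \<open>The preimage of a submodule under \<open>T\<close> is an invariant subspace, so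
    irreducibility leaves only two cases. Taken at the zero submodule this gives injectivity of
    \<open>T\<close>; taken at submodules of \<open>W\<close> it gives simplicity of
    \<open>W\<close>.\<close>
  have pre: "{v \<in> carrier_vec d. T v \<in> W'} = {0\<^sub>v d} \<or> {v \<in> carrier_vec d. T v \<in> W'} = carrier_vec d"
    if W': "submodule W'" for W'
  proof -
    have "invariant_subspace G d \<sigma> {v \<in> carrier_vec d. T v \<in> W'}"
      unfolding invariant_subspace_def
      using submoduleD[OF W'] mult_mat_vec_carrier[OF \<sigma>]
      by (auto simp: T0 Tadd Tsm Tact)
    thus ?thesis using irr by (simp add: irreducible_rep_def)
  qed
  have T1: "T (unit_vec d 0) \<noteq> (\<lambda>_. 0)"
  proof
    assume "T (unit_vec d 0) = (\<lambda>_. 0)"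
    hence "T (unit_vec d 0) e = 0" by simp
    thus False using d by (simp add: T_def \<sigma>e)
  qed
  have ker: "v = 0\<^sub>v d" if "v \<in> carrier_vec d" "T v = (\<lambda>_. 0)" for v
  proof -
    have "submodule {\<lambda>_. 0}" by (auto simp: submodule_def act_def)
    from pre[OF this] show ?thesis
    proof
      assume all: "{v \<in> carrier_vec d. T v \<in> {\<lambda>_. 0}} = carrier_vec d"
      have "unit_vec d 0 \<in> {v \<in> carrier_vec d. T v \<in> {\<lambda>_. 0}}" unfolding all by simp
      hence "T (unit_vec d 0) = (\<lambda>_. 0)" by simp
      thus ?thesis using T1 by simp
    qed (use that in auto)
  qed
  have "simple_submodule W"
    unfolding simple_submodule_def
  proof (intro conjI allI impI sub)
    have "T (unit_vec d 0) \<in> W" by (simp add: W_def)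
    thus "W \<noteq> {\<lambda>_. 0}" using T1 by blast
    fix W' assume W': "W' \<subseteq> W" "submodule W'"
    from pre[OF W'(2)] show "W' = {\<lambda>_. 0} \<or> W' = W"
    proof
      assume z: "{v \<in> carrier_vec d. T v \<in> W'} = {0\<^sub>v d}"
      have "w = (\<lambda>_. 0)" if w: "w \<in> W'" for w
      proof -
        obtain v where "v \<in> carrier_vec d" "w = T v" using w W' by (auto simp: W_def)
        hence "v \<in> {v \<in> carrier_vec d. T v \<in> W'}" using w by simp
        hence "v = 0\<^sub>v d" unfolding z by simp
        thus ?thesis using \<open>w = T v\<close> T0 by simp
      qed
      thus ?thesis using submoduleD(2)[OF W'(2)] by blast
    next
      assume all: "{v \<in> carrier_vec d. T v \<in> W'} = carrier_vec d"
      have "T v \<in> W'" if "v \<in> carrier_vec d" for v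
      proof -
        have "v \<in> {v \<in> carrier_vec d. T v \<in> W'}" unfolding all by (rule that)
        thus ?thesis by simp
      qed
      hence "W \<subseteq> W'" by (auto simp: W_def)
      thus ?thesis using W' by blast
    qed
  qed
  then obtain d' \<tau> b where t: "unitary_irrep d' \<tau>" and on: "orthonormal d' b"
    and bW: "\<forall>i<d'. b i \<in> W" and ex: "\<forall>v\<in>W. comb b (coords d' b v) = v"
    and ac: "\<forall>g\<in>G. \<forall>c\<in>carrier_vec d'. act g (comb b c) = comb b (\<tau> g *\<^sub>v c)"
    by (rule simple_submodule_irrep)
  have \<tau>: "\<tau> g \<in> carrier_mat d' d'" if "g \<in> G" for g
    using t that by (simp add: unitary_irrep_def irreducible_rep_def group_matrix_rep_def)
  \<comment> \<open>The matrix of \<open>T\<close> from the unit vectors to the orthonormal basis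
    \<open>b\<close>; it is the intertwiner between \<open>\<sigma>\<close> and
    \<open>\<tau>\<close>.\<close>
  define P where "P = mat d' d (\<lambda>(i, j). hp (T (unit_vec d j)) (b i))"
  have P: "P \<in> carrier_mat d' d" by (simp add: P_def)
  have Tsum: "T v = (\<lambda>x. \<Sum>j<d. v $ j * T (unit_vec d j) x)" if v: "v \<in> carrier_vec d" for v
  proof
    fix x show "T v x = (\<Sum>j<d. v $ j * T (unit_vec d j) x)"
    proof (cases "x \<in> G")
      case True
      have "(\<sigma> x *\<^sub>v unit_vec d j) $ 0 = \<sigma> x $$ (0, j)" if "j < d" for j
        using \<sigma>[OF True] d that by simp
      thus ?thesis using \<sigma>[OF True] d v True
        by (simp add: T_def scalar_prod_def lessThan_atLeast0 mult.commute)
    qed (simp add: T_def)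
  qed
  have Pv: "P *\<^sub>v v = coords d' b (T v)" if v: "v \<in> carrier_vec d" for v
  proof (rule eq_vecI)
    fix i assume i: "i < dim_vec (coords d' b (T v))"
    have "hp (T v) (b i) = (\<Sum>j<d. v $ j * hp (T (unit_vec d j)) (b i))"
      by (subst Tsum[OF v]) (simp add: hp_sum_left hp_scale_left)
    thus "(P *\<^sub>v v) $ i = coords d' b (T v) $ i" using i v
      by (simp add: P_def coords_def scalar_prod_def lessThan_atLeast0 mult.commute)
  qed (simp add: P_def)
  have TW: "T v \<in> W" if "v \<in> carrier_vec d" for v using that by (simp add: W_def)
  have comb0: "comb b (0\<^sub>v d') = (\<lambda>_. 0)" by (simp add: comb_def)
  have "d' = d \<and> (\<exists>Q\<in>carrier_mat d d'. P * Q = 1\<^sub>m d' \<and> Q * P = 1\<^sub>m d)"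
  proof (rule bijective_mat_inverse[OF P])
    fix v :: "complex vec" assume v: "v \<in> carrier_vec d" "P *\<^sub>v v = 0\<^sub>v d'"
    hence "T v = (\<lambda>_. 0)" using Pv bspec[OF ex TW[OF v(1)]] comb0 by simp
    thus "v = 0\<^sub>v d" using ker v by blast
  next
    fix w :: "complex vec" assume w: "w \<in> carrier_vec d'"
    have "comb b w \<in> W" using w bW by (intro submodule_comb[OF sub]) auto
    then obtain v where v: "v \<in> carrier_vec d" "comb b w = T v" by (auto simp: W_def)
    hence "P *\<^sub>v v = w" using Pv coords_comb[OF on w] by simp
    thus "\<exists>v\<in>carrier_vec d. P *\<^sub>v v = w" using v by blast
  qed
  then obtain Q where dd: "d' = d" and Q: "Q \<in> carrier_mat d d'" "P * Q = 1\<^sub>m d'" "Q * P = 1\<^sub>m d" by blast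
  have "P * \<sigma> g = \<tau> g * P" if g: "g \<in> G" for g
  proof (rule eq_mat_on_vec)
    fix v :: "complex vec" assume v: "v \<in> carrier_vec d"
    have gv: "\<sigma> g *\<^sub>v v \<in> carrier_vec d" by (rule mult_mat_vec_carrier[OF \<sigma>[OF g] v])
    have "P * \<sigma> g *\<^sub>v v = P *\<^sub>v (\<sigma> g *\<^sub>v v)" by (rule assoc_mult_mat_vec[OF P \<sigma>[OF g] v])
    also have "\<dots> = coords d' b (act g (T v))" using Pv[OF gv] Tact[OF g v] by simp
    also have "act g (T v) = act g (comb b (coords d' b (T v)))" using bspec[OF ex TW[OF v]] by simp
    also have "\<dots> = comb b (\<tau> g *\<^sub>v coords d' b (T v))" using ac g by simp
    also have "coords d' b \<dots> = \<tau> g *\<^sub>v coords d' b (T v)"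
      by (rule coords_comb[OF on mult_mat_vec_carrier[OF \<tau>[OF g]]]) simp
    also have "\<dots> = \<tau> g *\<^sub>v (P *\<^sub>v v)" using Pv[OF v] by simp
    also have "\<dots> = \<tau> g * P *\<^sub>v v" by (rule assoc_mult_mat_vec[OF \<tau>[OF g] P v, symmetric])
    finally show "P * \<sigma> g *\<^sub>v v = \<tau> g * P *\<^sub>v v" .
  qed (use P \<sigma>[OF g] \<tau>[OF g] in auto)
  hence "equivalent_reps G d \<sigma> d' \<tau>" using P Q dd by (auto simp: equivalent_reps_def)
  thus thesis using that t by blast
qed

section \<open>Schur's lemma and the number of irreducible representations\<close>

lemma unitary_irrepD:
  assumes "unitary_irrep d \<sigma>"
  shows "irreducible_rep G e d \<sigma>" "group_matrix_rep G e d \<sigma>" "0 < d"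
    "g \<in> G \<Longrightarrow> \<sigma> g \<in> carrier_mat d d" "\<sigma> e = 1\<^sub>m d" "g \<in> G \<Longrightarrow> \<sigma> (gi g) = mat_adjoint (\<sigma> g)"
  using assms by (auto simp: unitary_irrep_def irreducible_rep_def group_matrix_rep_def)

text \<open>Kernel and range of an intertwiner are invariant. For a nonzero one irreducibility makes
  the kernel zero and the range everything.\<close>

lemma Schur_lemma:
  assumes \<sigma>: "irreducible_rep G e d \<sigma>" and \<tau>: "irreducible_rep G e d' \<tau>"
    and A: "A \<in> carrier_mat d d'" and comm: "\<And>g. g \<in> G \<Longrightarrow> A * \<tau> g = \<sigma> g * A"
    and ne: "A \<noteq> 0\<^sub>m d d'"
  shows "equivalent_reps G d' \<tau> d \<sigma>"
proof -
  have \<sigma>c: "\<sigma> g \<in> carrier_mat d d" if "g \<in> G" for g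
    using \<sigma> that by (simp add: irreducible_rep_def group_matrix_rep_def)
  have \<tau>c: "\<tau> g \<in> carrier_mat d' d'" if "g \<in> G" for g
    using \<tau> that by (simp add: irreducible_rep_def group_matrix_rep_def)
  have commv: "A *\<^sub>v (\<tau> g *\<^sub>v v) = \<sigma> g *\<^sub>v (A *\<^sub>v v)" if "g \<in> G" "v \<in> carrier_vec d'" for g v
    using assoc_mult_mat_vec[OF A \<tau>c that(2)] assoc_mult_mat_vec[OF \<sigma>c A that(2)] comm that(1) by simp
  obtain v0 where v0: "v0 \<in> carrier_vec d'" "A *\<^sub>v v0 \<noteq> 0\<^sub>v d"
  proof (rule ccontr)
    assume no: "\<not> thesis"
    have "A = 0\<^sub>m d d'"
    proof (rule eq_mat_on_vec[OF A])
      fix v :: "complex vec" assume v: "v \<in> carrier_vec d'"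
      hence "A *\<^sub>v v = 0\<^sub>v d" using no that by blast
      thus "A *\<^sub>v v = 0\<^sub>m d d' *\<^sub>v v" using v by (auto intro!: eq_vecI)
    qed simp
    thus False using ne by simp
  qed
  define K where "K = {v \<in> carrier_vec d'. A *\<^sub>v v = 0\<^sub>v d}"
  have A0: "A *\<^sub>v 0\<^sub>v d' = 0\<^sub>v d" using A by (auto intro!: eq_vecI)
  have "invariant_subspace G d' \<tau> K"
    unfolding invariant_subspace_def
  proof (intro conjI ballI allI)
    fix v w assume "v \<in> K" "w \<in> K" thus "v + w \<in> K"
      using A by (auto simp: K_def mult_add_distrib_mat_vec[OF A])
  next
    fix c v assume "v \<in> K" thus "c \<cdot>\<^sub>v v \<in> K"
      using A by (auto simp: K_def mult_mat_vec[OF A])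
  next
    fix g v assume g: "g \<in> G" and v: "v \<in> K"
    have "\<sigma> g *\<^sub>v 0\<^sub>v d = 0\<^sub>v d" using \<sigma>c[OF g] by (auto intro!: eq_vecI)
    thus "\<tau> g *\<^sub>v v \<in> K" using v commv[OF g] mult_mat_vec_carrier[OF \<tau>c[OF g]] by (auto simp: K_def)
  qed (auto simp: K_def A0)
  hence "K = {0\<^sub>v d'} \<or> K = carrier_vec d'" using \<tau> by (simp add: irreducible_rep_def)
  hence K: "K = {0\<^sub>v d'}" using v0 by (auto simp: K_def)
  define R where "R = (\<lambda>v. A *\<^sub>v v) ` carrier_vec d'"
  have Av: "A *\<^sub>v v \<in> carrier_vec d" if "v \<in> carrier_vec d'" for v
    by (rule mult_mat_vec_carrier[OF A that])
  have "invariant_subspace G d \<sigma> R"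
    unfolding invariant_subspace_def
  proof (intro conjI ballI allI)
    show "R \<subseteq> carrier_vec d" using Av by (auto simp: R_def)
    show "0\<^sub>v d \<in> R" unfolding R_def by (rule image_eqI[of _ _ "0\<^sub>v d'"]) (simp_all add: A0)
  next
    fix v w assume "v \<in> R" "w \<in> R"
    then obtain a b where "a \<in> carrier_vec d'" "b \<in> carrier_vec d'" "v = A *\<^sub>v a" "w = A *\<^sub>v b"
      by (auto simp: R_def)
    thus "v + w \<in> R" unfolding R_def
      by (intro image_eqI[of _ _ "a + b"]) (auto simp: mult_add_distrib_mat_vec[OF A])
  next
    fix c v assume "v \<in> R"
    then obtain a where "a \<in> carrier_vec d'" "v = A *\<^sub>v a" by (auto simp: R_def)
    thus "c \<cdot>\<^sub>v v \<in> R" unfolding R_def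
      by (intro image_eqI[of _ _ "c \<cdot>\<^sub>v a"]) (auto simp: mult_mat_vec[OF A])
  next
    fix g v assume g: "g \<in> G" and "v \<in> R"
    then obtain a where a: "a \<in> carrier_vec d'" "v = A *\<^sub>v a" by (auto simp: R_def)
    show "\<sigma> g *\<^sub>v v \<in> R" unfolding R_def a(2) commv[OF g a(1), symmetric]
      by (rule imageI, rule mult_mat_vec_carrier[OF \<tau>c[OF g] a(1)])
  qed
  hence "R = {0\<^sub>v d} \<or> R = carrier_vec d" using \<sigma> by (simp add: irreducible_rep_def)
  moreover have "A *\<^sub>v v0 \<in> R" using v0 by (simp add: R_def)
  ultimately have R: "R = carrier_vec d" using v0 by auto
  have "d = d' \<and> (\<exists>Q\<in>carrier_mat d' d. A * Q = 1\<^sub>m d \<and> Q * A = 1\<^sub>m d')"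
  proof (rule bijective_mat_inverse[OF A])
    fix v :: "complex vec" assume "v \<in> carrier_vec d'" "A *\<^sub>v v = 0\<^sub>v d"
    hence "v \<in> K" by (simp add: K_def)
    thus "v = 0\<^sub>v d'" by (simp add: K)
  next
    fix w :: "complex vec" assume "w \<in> carrier_vec d"
    hence "w \<in> R" by (simp add: R)
    thus "\<exists>v\<in>carrier_vec d'. A *\<^sub>v v = w" by (auto simp: R_def)
  qed
  thus ?thesis using A comm by (auto simp: equivalent_reps_def)
qed

text \<open>The matrix \<open>A\<close> is the sum over \<open>g\<close> of
  \<open>\<sigma> g\<close>, the matrix unit at (0, 0), and the adjoint of \<open>\<tau> g\<close>,
  multiplied in this order. Summation over the group makes it an intertwiner, so it vanishes, and
  its entry (0, 0) is the inner product in question.\<close>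

lemma Schur_orthogonality:
  assumes \<sigma>: "unitary_irrep d \<sigma>" and \<tau>: "unitary_irrep d' \<tau>"
    and ineq: "\<not> equivalent_reps G d' \<tau> d \<sigma>"
  shows "hp (\<lambda>x. \<sigma> x $$ (0, 0)) (\<lambda>x. \<tau> x $$ (0, 0)) = 0"
proof -
  note S = unitary_irrepD[OF \<sigma>] and T = unitary_irrepD[OF \<tau>]
  define A where "A = mat d d' (\<lambda>(i, j). \<Sum>g\<in>G. \<sigma> g $$ (i, 0) * cnj (\<tau> g $$ (j, 0)))"
  have A: "A \<in> carrier_mat d d'" by (simp add: A_def)
  have "A * \<tau> h = \<sigma> h * A" if h: "h \<in> G" for h
  proof (rule eq_matI)
    fix i j assume "i < dim_row (\<sigma> h * A)" "j < dim_col (\<sigma> h * A)"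
    hence ij: "i < d" "j < d'" using A S(4)[OF h] by auto
    have gih: "gi h \<in> G" using h by simp
    have \<tau>h: "\<tau> h $$ (k, j) = cnj (\<tau> (gi h) $$ (j, k))" if "k < d'" for k
      using T(6)[OF gih] T(4)[OF gih] h that ij by simp
    have "(A * \<tau> h) $$ (i, j) = (\<Sum>k<d'. (\<Sum>g\<in>G. \<sigma> g $$ (i, 0) * cnj (\<tau> g $$ (k, 0))) * \<tau> h $$ (k, j))"
      using ij T(4)[OF h] by (simp add: A_def scalar_prod_def lessThan_atLeast0)
    also have "\<dots> = (\<Sum>k<d'. \<Sum>g\<in>G. \<sigma> g $$ (i, 0) * cnj (\<tau> (gi h) $$ (j, k) * \<tau> g $$ (k, 0)))"
      by (intro sum.cong) (auto simp: sum_distrib_left \<tau>h mult_ac)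
    also have "\<dots> = (\<Sum>g\<in>G. \<Sum>k<d'. \<sigma> g $$ (i, 0) * cnj (\<tau> (gi h) $$ (j, k) * \<tau> g $$ (k, 0)))"
      by (rule sum.swap)
    also have "\<dots> = (\<Sum>g\<in>G. \<sigma> g $$ (i, 0) * cnj (\<tau> (gi h * g) $$ (j, 0)))"
      using group_matrix_rep_entry[OF T(2) gih] ij T(3)
      by (intro sum.cong) (auto simp: sum_distrib_left)
    \<comment> \<open>Replacing \<open>g\<close> by \<open>h * g\<close> moves the factor
      \<open>h\<close> from the side of \<open>\<tau>\<close> to the side of
      \<open>\<sigma>\<close>.\<close>
    also have "\<dots> = (\<Sum>g\<in>G. \<sigma> (h * g) $$ (i, 0) * cnj (\<tau> (gi h * (h * g)) $$ (j, 0)))"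
      by (rule sum.reindex_bij_betw[OF bij_betw_left_mult[OF h], symmetric])
    also have "\<dots> = (\<Sum>g\<in>G. \<Sum>k<d. \<sigma> h $$ (i, k) * \<sigma> g $$ (k, 0) * cnj (\<tau> g $$ (j, 0)))"
      using group_matrix_rep_entry[OF S(2) h] ij S(3) h
      by (intro sum.cong) (auto simp: sum_distrib_right)
    also have "\<dots> = (\<Sum>k<d. \<Sum>g\<in>G. \<sigma> h $$ (i, k) * \<sigma> g $$ (k, 0) * cnj (\<tau> g $$ (j, 0)))"
      by (rule sum.swap)
    also have "\<dots> = (\<sigma> h * A) $$ (i, j)"
      using ij S(4)[OF h] by (simp add: A_def scalar_prod_def lessThan_atLeast0 sum_distrib_left mult.assoc)
    finally show "(A * \<tau> h) $$ (i, j) = (\<sigma> h * A) $$ (i, j)" .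
  qed (use A S(4)[OF h] T(4)[OF h] in auto)
  hence "A = 0\<^sub>m d d'" using Schur_lemma[OF S(1) T(1) A] ineq by blast
  hence "A $$ (0, 0) = 0" using S(3) T(3) by simp
  thus ?thesis using S(3) T(3) by (simp add: A_def hp_def)
qed

definition inequivalent_unitary :: "(nat \<times> ('a \<Rightarrow> complex mat)) list \<Rightarrow> bool" where
  "inequivalent_unitary sigs \<longleftrightarrow> (\<forall>k<length sigs. unitary_irrep (fst (sigs!k)) (snd (sigs!k))) \<and>
     (\<forall>k<length sigs. \<forall>l<length sigs. k \<noteq> l \<longrightarrow>
        \<not> equivalent_reps G (fst (sigs!k)) (snd (sigs!k)) (fst (sigs!l)) (snd (sigs!l)))"

text \<open>One coefficient per representation suffices: the entries (0, 0) are pairwise orthogonal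
  functions, nonzero because they take the value 1 at \<open>e\<close>, and after normalisation
  \<open>orthonormal_bound\<close> applies.\<close>

lemma inequivalent_unitary_bound:
  assumes "inequivalent_unitary sigs"
  shows "length sigs \<le> card G"
proof -
  define f where "f k = (\<lambda>x. snd (sigs!k) x $$ (0, 0))" for k
  define r where "r k = (\<Sum>x\<in>G. (cmod (f k x))\<^sup>2)" for k
  have U: "unitary_irrep (fst (sigs!k)) (snd (sigs!k))" if "k < length sigs" for k
    using assms that by (simp add: inequivalent_unitary_def)
  have orth: "hp (f k) (f l) = 0" if "k < length sigs" "l < length sigs" "k \<noteq> l" for k l
    unfolding f_def using assms that
    by (intro Schur_orthogonality[OF U U]) (auto simp: inequivalent_unitary_def)
  have pos: "r k > 0" if k: "k < length sigs" for k
  proof -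
    have "f k e = 1" using unitary_irrepD(3,5)[OF U[OF k]] by (simp add: f_def)
    thus ?thesis unfolding r_def by (intro sum_pos2[of _ e]) auto
  qed
  define b where "b k = (\<lambda>x. of_real (1 / sqrt (r k)) * f k x)" for k
  have "hp (b k) (b k) = 1" if "k < length sigs" for k
    using pos[OF that] unfolding b_def hp_scale_left hp_scale_right hp_self r_def[symmetric]
    by (simp add: of_real_mult[symmetric] del: of_real_mult of_real_divide)
  moreover have "hp (b k) (b l) = 0" if "k < length sigs" "l < length sigs" "k \<noteq> l" for k l
    unfolding b_def hp_scale_left hp_scale_right orth[OF that] by simp
  ultimately have "orthonormal (length sigs) b" by (simp add: orthonormal_def)
  thus ?thesis by (rule orthonormal_bound)
qed

text \<open>A list of maximal length is complete: a missing irreducible representation has a unitary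
  equivalent, which could be appended.\<close>

lemma complete_unitary_irreps_exist:
  obtains sigs where "complete_irreps G e sigs" "inequivalent_unitary sigs"
proof -
  have "inequivalent_unitary []" by (simp add: inequivalent_unitary_def)
  hence "\<exists>s. inequivalent_unitary s \<and> (\<forall>s'. inequivalent_unitary s' \<longrightarrow> length s' \<le> length s)"
    by (rule ex_has_greatest_nat[where b = "Suc (card G)"]) (simp add: inequivalent_unitary_bound less_Suc_eq_le)
  then obtain sigs where iu: "inequivalent_unitary sigs"
    and max: "\<And>s. inequivalent_unitary s \<Longrightarrow> length s \<le> length sigs" by blast
  have U: "unitary_irrep (fst (sigs!k)) (snd (sigs!k))" if "k < length sigs" for k
    using iu that by (simp add: inequivalent_unitary_def)
  have "\<exists>k<length sigs. equivalent_reps G d \<sigma> (fst (sigs!k)) (snd (sigs!k))"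
    if \<sigma>: "irreducible_rep G e d \<sigma>" for d \<sigma>
  proof -
    obtain d' \<tau> where \<tau>: "unitary_irrep d' \<tau>" and eq: "equivalent_reps G d \<sigma> d' \<tau>"
      by (rule irrep_equivalent_unitary[OF \<sigma>])
    have \<sigma>c: "\<sigma> g \<in> carrier_mat d d" if "g \<in> G" for g
      using \<sigma> that by (simp add: irreducible_rep_def group_matrix_rep_def)
    have "\<exists>k<length sigs. equivalent_reps G d' \<tau> (fst (sigs!k)) (snd (sigs!k))"
    proof (rule ccontr)
      assume no: "\<not> ?thesis"
      have no': "\<not> equivalent_reps G (fst (sigs!k)) (snd (sigs!k)) d' \<tau>" if k: "k < length sigs" for k
        using no k equivalent_reps_sym[of G "fst (sigs!k)" "snd (sigs!k)" d' \<tau>]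
          unitary_irrepD(4)[OF U[OF k]] unitary_irrepD(4)[OF \<tau>] by blast
      have "inequivalent_unitary (sigs @ [(d', \<tau>)])"
        using iu \<tau> no no' by (auto simp: inequivalent_unitary_def nth_append less_Suc_eq)
      hence "length (sigs @ [(d', \<tau>)]) \<le> length sigs" by (rule max)
      thus False by simp
    qed
    then obtain k where k: "k < length sigs" "equivalent_reps G d' \<tau> (fst (sigs!k)) (snd (sigs!k))" by blast
    have "equivalent_reps G d \<sigma> (fst (sigs!k)) (snd (sigs!k))"
      by (rule equivalent_reps_trans[OF eq k(2)])
         (use \<sigma>c unitary_irrepD(4)[OF \<tau>] unitary_irrepD(4)[OF U[OF k(1)]] in auto)
    thus ?thesis using k by blast
  qed
  hence "complete_irreps G e sigs"
    using iu U unitary_irrepD(1) by (simp add: complete_irreps_def inequivalent_unitary_def)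
  thus thesis using that iu by blast
qed

end

section \<open>Induced representations\<close>

lemma mult_diag_four_block_mat:
  fixes A B A' B' :: "complex mat"
  assumes "A \<in> carrier_mat m m" "A' \<in> carrier_mat m m" "B \<in> carrier_mat n n" "B' \<in> carrier_mat n n"
  shows "four_block_mat A (0\<^sub>m m n) (0\<^sub>m n m) B * four_block_mat A' (0\<^sub>m m n) (0\<^sub>m n m) B' =
    four_block_mat (A * A') (0\<^sub>m m n) (0\<^sub>m n m) (B * B')"
  using assms
  by (subst mult_four_block_mat[OF assms(1) zero_carrier_mat zero_carrier_mat assms(3)
        assms(2) zero_carrier_mat zero_carrier_mat assms(4)]) simp

lemma mat_adjoint_diag_four_block_mat:
  fixes A B :: "complex mat"
  assumes "A \<in> carrier_mat m m" "B \<in> carrier_mat n n"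
  shows "mat_adjoint (four_block_mat A (0\<^sub>m m n) (0\<^sub>m n m) B) =
    four_block_mat (mat_adjoint A) (0\<^sub>m m n) (0\<^sub>m n m) (mat_adjoint B)"
  by (rule eq_matI) (use assms in \<open>auto simp: not_less\<close>)

lemma diag_four_block_mat_inject:
  fixes A B A' B' :: "complex mat"
  assumes c: "A \<in> carrier_mat m m" "A' \<in> carrier_mat m m" "B \<in> carrier_mat n n" "B' \<in> carrier_mat n n"
    and eq: "four_block_mat A (0\<^sub>m m n) (0\<^sub>m n m) B = four_block_mat A' (0\<^sub>m m n) (0\<^sub>m n m) B'"
  shows "A = A' \<and> B = B'"
proof
  show "A = A'"
  proof (rule eq_matI)
    fix i j assume "i < dim_row A'" "j < dim_col A'"
    thus "A $$ (i, j) = A' $$ (i, j)"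
      using c arg_cong[OF eq, of "\<lambda>M. M $$ (i, j)"] by simp
  qed (use c in auto)
  show "B = B'"
  proof (rule eq_matI)
    fix i j assume "i < dim_row B'" "j < dim_col B'"
    thus "B $$ (i, j) = B' $$ (i, j)"
      using c arg_cong[OF eq, of "\<lambda>M. M $$ (i + m, j + m)"] by simp
  qed (use c in auto)
qed

lemma direct_sum_rep_carrier:
  assumes "\<forall>p\<in>set sigs. snd p g \<in> carrier_mat (fst p) (fst p)"
  shows "direct_sum_rep sigs g \<in> carrier_mat (rep_dim sigs) (rep_dim sigs)"
  using assms
  by (induction sigs) (auto simp: direct_sum_rep_def rep_dim_def Let_def intro!: four_block_carrier_mat)

lemma direct_sum_rep_Cons:
  assumes "\<forall>q\<in>set (p # sigs). snd q g \<in> carrier_mat (fst q) (fst q)"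
  shows "direct_sum_rep (p # sigs) g = four_block_mat (snd p g) (0\<^sub>m (fst p) (rep_dim sigs))
    (0\<^sub>m (rep_dim sigs) (fst p)) (direct_sum_rep sigs g)"
  using assms direct_sum_rep_carrier[of sigs g] by (auto simp: direct_sum_rep_def Let_def)

lemma direct_sum_rep_group_rep:
  assumes "\<forall>p\<in>set sigs. group_matrix_rep G e (fst p) (snd p)"
    and closed: "\<And>g h. g \<in> G \<Longrightarrow> h \<in> G \<Longrightarrow> g * h \<in> G" and e: "e \<in> G"
  shows "group_matrix_rep G e (rep_dim sigs) (direct_sum_rep sigs)"
  using assms(1)
proof (induction sigs)
  case Nil
  show ?case by (auto simp: group_matrix_rep_def direct_sum_rep_def rep_dim_def)
next
  case (Cons p sigs)
  have IH: "group_matrix_rep G e (rep_dim sigs) (direct_sum_rep sigs)" using Cons by simp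
  have car: "snd q g \<in> carrier_mat (fst q) (fst q)" if "q \<in> set (p # sigs)" "g \<in> G" for q g
    using Cons.prems that by (auto simp: group_matrix_rep_def)
  have C: "direct_sum_rep (p # sigs) g = four_block_mat (snd p g) (0\<^sub>m (fst p) (rep_dim sigs))
    (0\<^sub>m (rep_dim sigs) (fst p)) (direct_sum_rep sigs g)" if "g \<in> G" for g
    using direct_sum_rep_Cons[of p sigs g] car that by blast
  have p: "snd p e = 1\<^sub>m (fst p)" "\<And>g h. g \<in> G \<Longrightarrow> h \<in> G \<Longrightarrow> snd p (g * h) = snd p g * snd p h"
    "\<And>g. g \<in> G \<Longrightarrow> snd p g \<in> carrier_mat (fst p) (fst p)"
    using Cons.prems by (auto simp: group_matrix_rep_def)
  have s: "direct_sum_rep sigs e = 1\<^sub>m (rep_dim sigs)"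
    "\<And>g h. g \<in> G \<Longrightarrow> h \<in> G \<Longrightarrow> direct_sum_rep sigs (g * h) = direct_sum_rep sigs g * direct_sum_rep sigs h"
    "\<And>g. g \<in> G \<Longrightarrow> direct_sum_rep sigs g \<in> carrier_mat (rep_dim sigs) (rep_dim sigs)"
    using IH by (auto simp: group_matrix_rep_def)
  show ?case unfolding group_matrix_rep_def
  proof (intro conjI ballI)
    fix g assume "g \<in> G"
    thus "direct_sum_rep (p # sigs) g \<in> carrier_mat (rep_dim (p # sigs)) (rep_dim (p # sigs))"
      using car by (intro direct_sum_rep_carrier) auto
  next
    show "direct_sum_rep (p # sigs) e = 1\<^sub>m (rep_dim (p # sigs))"
      by (simp add: C[OF e] p(1) s(1) rep_dim_def)
  next
    fix g h assume g: "g \<in> G" and h: "h \<in> G"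
    show "direct_sum_rep (p # sigs) (g * h) = direct_sum_rep (p # sigs) g * direct_sum_rep (p # sigs) h"
      unfolding C[OF closed[OF g h]] C[OF g] C[OF h] p(2)[OF g h] s(2)[OF g h]
      by (rule mult_diag_four_block_mat[OF p(3)[OF g] p(3)[OF h] s(3)[OF g] s(3)[OF h], symmetric])
  qed
qed

lemma direct_sum_rep_adjoint:
  assumes "\<forall>p\<in>set sigs. snd p g \<in> carrier_mat (fst p) (fst p) \<and> snd p h = mat_adjoint (snd p g)"
  shows "direct_sum_rep sigs h = mat_adjoint (direct_sum_rep sigs g)"
  using assms
proof (induction sigs)
  case Nil
  show ?case by (rule eq_matI) (auto simp: direct_sum_rep_def)
next
  case (Cons p sigs)
  have IH: "direct_sum_rep sigs h = mat_adjoint (direct_sum_rep sigs g)" using Cons by simp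
  have g: "\<forall>q\<in>set (p # sigs). snd q g \<in> carrier_mat (fst q) (fst q)" using Cons.prems by auto
  hence h: "\<forall>q\<in>set (p # sigs). snd q h \<in> carrier_mat (fst q) (fst q)" using Cons.prems by auto
  have c: "direct_sum_rep sigs g \<in> carrier_mat (rep_dim sigs) (rep_dim sigs)"
    "snd p g \<in> carrier_mat (fst p) (fst p)"
    using direct_sum_rep_carrier g by auto
  show ?case unfolding direct_sum_rep_Cons[OF g] direct_sum_rep_Cons[OF h]
      mat_adjoint_diag_four_block_mat[OF c(2,1)] IH using Cons.prems by simp
qed

lemma direct_sum_rep_inject:
  assumes "\<forall>p\<in>set sigs. snd p g \<in> carrier_mat (fst p) (fst p) \<and> snd p h \<in> carrier_mat (fst p) (fst p)"
    and "direct_sum_rep sigs g = direct_sum_rep sigs h"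
  shows "\<forall>p\<in>set sigs. snd p g = snd p h"
  using assms
proof (induction sigs)
  case (Cons p sigs)
  have g: "\<forall>q\<in>set (p # sigs). snd q g \<in> carrier_mat (fst q) (fst q)"
    and h: "\<forall>q\<in>set (p # sigs). snd q h \<in> carrier_mat (fst q) (fst q)" using Cons.prems by auto
  have c: "direct_sum_rep sigs g \<in> carrier_mat (rep_dim sigs) (rep_dim sigs)"
    "direct_sum_rep sigs h \<in> carrier_mat (rep_dim sigs) (rep_dim sigs)"
    "snd p g \<in> carrier_mat (fst p) (fst p)" "snd p h \<in> carrier_mat (fst p) (fst p)"
    using direct_sum_rep_carrier g h by auto
  have "snd p g = snd p h \<and> direct_sum_rep sigs g = direct_sum_rep sigs h"
    by (rule diag_four_block_mat_inject[OF c(3,4,1,2)])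
       (use Cons.prems(2) in \<open>simp only: direct_sum_rep_Cons[OF g] direct_sum_rep_Cons[OF h]\<close>)
  thus ?case using Cons by simp
qed simp

section \<open>Faithfulness of the direct sum\<close>

lemma complete_irreps_rep:
  assumes "complete_irreps G e sigs" "p \<in> set sigs"
  shows "group_matrix_rep G e (fst p) (snd p)"
proof -
  obtain k where "k < length sigs" "sigs ! k = p" using assms(2) by (auto simp: in_set_conv_nth)
  hence "irreducible_rep G e (fst p) (snd p)" using assms(1) unfolding complete_irreps_def by blast
  thus ?thesis by (simp add: irreducible_rep_def)
qed

text \<open>If \<open>g\<close> and \<open>h\<close> have the same image, every member of the list
  is trivial at \<open>g * gi h\<close>. By completeness so is every irreducible representation, and
  these separate points.\<close>

lemma (in finite_subgroup) complete_irreps_faithful: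
  assumes c: "complete_irreps G e sigs" and g: "g \<in> G" and h: "h \<in> G"
    and eq: "direct_sum_rep sigs g = direct_sum_rep sigs h"
  shows "g = h"
proof -
  have rep: "group_matrix_rep G e (fst p) (snd p)" if "p \<in> set sigs" for p
    by (rule complete_irreps_rep[OF c that])
  have "\<forall>p\<in>set sigs. snd p g = snd p h"
    using rep g h by (intro direct_sum_rep_inject[OF _ eq]) (auto simp: group_matrix_rep_def)
  hence pn: "snd p (g * gi h) = 1\<^sub>m (fst p)" if p: "p \<in> set sigs" for p
  proof -
    have "snd p (g * gi h) = snd p g * snd p (gi h)"
      using rep[OF p] g gi_in[OF h] by (auto simp: group_matrix_rep_def)
    also have "snd p g = snd p h" using p \<open>\<forall>p\<in>set sigs. _\<close> by blast
    also have "snd p h * snd p (gi h) = snd p (h * gi h)"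
      using rep[OF p] h gi_in[OF h] unfolding group_matrix_rep_def by metis
    finally show ?thesis using rep[OF p] h by (simp add: group_matrix_rep_def)
  qed
  have n: "g * gi h \<in> G" using g h by simp
  have "g * gi h = e"
  proof (rule irreps_separate[OF n])
    fix d \<tau> assume \<tau>: "irreducible_rep G e d \<tau>"
    then obtain k where k: "k < length sigs" "equivalent_reps G d \<tau> (fst (sigs!k)) (snd (sigs!k))"
      using c unfolding complete_irreps_def by blast
    have "\<tau> (g * gi h) \<in> carrier_mat d d"
      using \<tau> n by (simp add: irreducible_rep_def group_matrix_rep_def)
    thus "\<tau> (g * gi h) = 1\<^sub>m d"
      using equivalent_reps_one[OF k(2) n] pn k(1) by simp
  qed
  hence "g * gi h * h = h" using h by simp
  thus ?thesis using g h by simp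
qed

text \<open>Positive block size is what makes \<open>div\<close> and \<open>mod\<close> recover
  block and position from a matrix index, and what separates an invertible block from a zero
  block.\<close>

lemma (in finite_subgroup) complete_irreps_dim_pos:
  assumes "complete_irreps G e sigs"
  shows "0 < rep_dim sigs"
proof -
  obtain d \<tau> where "irreducible_rep G e d \<tau>" using unitary_irrep_exists unitary_irrepD(1) by blast
  then obtain k where k: "k < length sigs" using assms unfolding complete_irreps_def by blast
  hence "0 < fst (sigs ! k)" using assms by (simp add: complete_irreps_def irreducible_rep_def)
  moreover have "fst (sigs ! k) \<le> rep_dim sigs"
    unfolding rep_dim_def using k by (intro member_le_sum_list) auto
  ultimately show ?thesis by simp
qed

section \<open>Index arithmetic for block matrices\<close>

lemma mult_mat_entry:
  fixes A B :: "complex mat"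
  assumes "A \<in> carrier_mat m k" "B \<in> carrier_mat k n" "i < m" "j < n"
  shows "(A * B) $$ (i, j) = (\<Sum>p<k. A $$ (i, p) * B $$ (p, j))"
  using assms by (simp add: scalar_prod_def lessThan_atLeast0)

lemma sum_blocks:
  fixes f :: "nat \<Rightarrow> 'b::comm_monoid_add"
  shows "(\<Sum>p<n * D. f p) = (\<Sum>k<n. \<Sum>t<D. f (k * D + t))"
proof -
  have "sum f {k * D..<k * D + D} = (\<Sum>t<D. f (k * D + t))" for k
    using sum.shift_bounds_nat_ivl[of f 0 "k * D" D] by (simp add: lessThan_atLeast0 add.commute)
  thus ?thesis using sum.nat_group[of f D n] by simp
qed

lemma block_index_less: "j < n \<Longrightarrow> r < D \<Longrightarrow> j * D + r < n * (D::nat)"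
  by (metis add.commute add_less_le_mono less_eq_Suc_le mult_Suc mult_le_mono1 order_less_le_trans
      nat_add_left_cancel_less)

lemma eq_block_matI:
  fixes A B :: "complex mat"
  assumes A: "A \<in> carrier_mat (n * D) (n * D)" and B: "B \<in> carrier_mat (n * D) (n * D)" and "0 < D"
    and eq: "\<And>j i r s. j < n \<Longrightarrow> i < n \<Longrightarrow> r < D \<Longrightarrow> s < D \<Longrightarrow>
      A $$ (j * D + r, i * D + s) = B $$ (j * D + r, i * D + s)"
  shows "A = B"
proof (rule eq_matI)
  fix p q assume "p < dim_row B" "q < dim_col B"
  hence "p div D < n" "q div D < n" using B by (auto simp: less_mult_imp_div_less)
  thus "A $$ (p, q) = B $$ (p, q)"
    using eq[of "p div D" "q div D" "p mod D" "q mod D"] \<open>0 < D\<close> by simp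
qed (use A B in auto)

section \<open>The induced representation and the partial action that it encodes\<close>

locale induced_rep =
  fixes e :: "'a::{semigroup_mult,finite}" and xs :: "'a list"
    and sigs :: "(nat \<times> ('a \<Rightarrow> complex mat)) list"
  assumes idem: "e * e = e" and trans: "left_transversal e xs"
    and complete: "complete_irreps (H_group e) e sigs"
begin

sublocale finite_subgroup "H_group e" e "H_inv e"
  using subgroup_H_group[OF idem]
  by (auto simp: finite_subgroup_def finite_subgroup_axioms_def)

abbreviation "D \<equiv> rep_dim sigs"
abbreviation "\<sigma> \<equiv> direct_sum_rep sigs"
abbreviation "n \<equiv> length xs"

definition blk :: "'a \<Rightarrow> nat \<Rightarrow> nat \<Rightarrow> complex mat" where
  "blk u j i = (if \<exists>g\<in>H_group e. u * xs!i = xs!j * g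
     then \<sigma> (THE g. g \<in> H_group e \<and> u * xs!i = xs!j * g) else 0\<^sub>m D D)"

lemma D_pos: "0 < D" by (rule complete_irreps_dim_pos[OF complete])

lemma \<sigma>_rep: "group_matrix_rep (H_group e) e D \<sigma>"
  by (rule direct_sum_rep_group_rep)
     (use complete_irreps_rep[OF complete] in auto)

lemma \<sigma>_carrier: "g \<in> H_group e \<Longrightarrow> \<sigma> g \<in> carrier_mat D D"
  and \<sigma>_e: "\<sigma> e = 1\<^sub>m D"
  and \<sigma>_mult: "g \<in> H_group e \<Longrightarrow> h \<in> H_group e \<Longrightarrow> \<sigma> (g * h) = \<sigma> g * \<sigma> h"
  using \<sigma>_rep by (auto simp: group_matrix_rep_def)

text \<open>Invertible blocks of positive size cannot be zero, so the matrix shows where the partial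
  action is defined.\<close>

lemma \<sigma>_nonzero:
  assumes g: "g \<in> H_group e"
  shows "\<sigma> g \<noteq> 0\<^sub>m D D"
proof
  assume z: "\<sigma> g = 0\<^sub>m D D"
  have "1\<^sub>m D = \<sigma> g * \<sigma> (H_inv e g)"
    unfolding \<sigma>_mult[OF g gi_in[OF g], symmetric] using g by (simp add: \<sigma>_e)
  also have "\<dots> = 0\<^sub>m D D" unfolding z by (rule left_mult_zero_mat[OF \<sigma>_carrier[OF gi_in[OF g]]])
  finally have "(1\<^sub>m D :: complex mat) $$ (0, 0) = 0\<^sub>m D D $$ (0, 0)" by simp
  thus False using D_pos by simp
qed

lemma xs_L: "i < n \<Longrightarrow> xs!i \<in> L_class e"
  using conjunct1[OF trans[unfolded left_transversal_def]] by (auto dest: subsetD)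

lemma L_class_decomp:
  assumes "x \<in> L_class e"
  obtains k g where "k < n" "g \<in> H_group e" "x = xs!k * g"
  using assms trans unfolding left_transversal_def by blast

lemma transversal_unique:
  assumes "k < n" "l < n" "g \<in> H_group e" "h \<in> H_group e" "xs!k * g = xs!l * h"
  shows "k = l"
proof (rule ccontr)
  assume "k \<noteq> l"
  hence "(\<lambda>g. xs!k * g) ` H_group e \<inter> (\<lambda>g. xs!l * g) ` H_group e = {}"
    using trans assms by (simp add: left_transversal_def)
  moreover have "xs!k * g \<in> (\<lambda>g. xs!k * g) ` H_group e" "xs!l * h \<in> (\<lambda>g. xs!l * g) ` H_group e"
    using assms(3,4) by blast+
  ultimately show False unfolding assms(5) by blast
qed

lemma blk_eq:
  assumes "j < n" "g \<in> H_group e" "u * xs!i = xs!j * g"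
  shows "blk u j i = \<sigma> g"
proof -
  have "(THE g. g \<in> H_group e \<and> u * xs!i = xs!j * g) = g"
    using assms L_class_cancel[OF idem xs_L[OF assms(1)]] by (intro the_equality) auto
  thus ?thesis using assms by (auto simp: blk_def)
qed

lemma blk_zero:
  assumes "\<And>g. g \<in> H_group e \<Longrightarrow> u * xs!i \<noteq> xs!j * g"
  shows "blk u j i = 0\<^sub>m D D"
  using assms by (auto simp: blk_def)

lemma blk_carrier: "j < n \<Longrightarrow> blk u j i \<in> carrier_mat D D"
  by (cases "\<exists>g\<in>H_group e. u * xs!i = xs!j * g") (auto simp: blk_eq \<sigma>_carrier blk_zero)

lemma blk_nonzeroE:
  assumes "j < n" "blk u j i \<noteq> 0\<^sub>m D D"
  obtains g where "g \<in> H_group e" "u * xs!i = xs!j * g" "blk u j i = \<sigma> g"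
  using assms blk_eq blk_zero by metis

lemma Ind_carrier: "Ind_rep e xs sigs u \<in> carrier_mat (n * D) (n * D)"
  by (simp add: Ind_rep_def Let_def)

lemma Ind_entry:
  assumes "j < n" "i < n" "r < D" "s < D"
  shows "Ind_rep e xs sigs u $$ (j * D + r, i * D + s) = blk u j i $$ (r, s)"
proof -
  \<comment> \<open>The equation \<open>u * xs!i = xs!j * g\<close> places the product in the
    L-class, so the test in \<open>Ind_rep\<close> and the one in \<open>blk\<close> agree.\<close>
  have "xs!j * g \<in> L_class e" if "g \<in> H_group e" for g
    using L_class_mult_H[OF idem xs_L[OF assms(1)] that] .
  thus ?thesis using assms
    by (auto simp: Ind_rep_def Let_def blk_def block_index_less)
qed

lemma Ind_eq_iff:
  "Ind_rep e xs sigs u = Ind_rep e xs sigs v \<longleftrightarrow> (\<forall>j<n. \<forall>i<n. blk u j i = blk v j i)"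
proof
  assume eq: "Ind_rep e xs sigs u = Ind_rep e xs sigs v"
  show "\<forall>j<n. \<forall>i<n. blk u j i = blk v j i"
  proof (intro allI impI)
    fix j i assume ji: "j < n" "i < n"
    show "blk u j i = blk v j i"
      by (rule eq_matI) (use ji blk_carrier[OF ji(1), of u i] blk_carrier[OF ji(1), of v i] eq
          in \<open>auto simp: Ind_entry[symmetric]\<close>)
  qed
next
  assume "\<forall>j<n. \<forall>i<n. blk u j i = blk v j i"
  thus "Ind_rep e xs sigs u = Ind_rep e xs sigs v"
    by (intro eq_block_matI[OF Ind_carrier Ind_carrier D_pos]) (simp add: Ind_entry)
qed

lemma Ind_adjoint_iff:
  "Ind_rep e xs sigs v = mat_adjoint (Ind_rep e xs sigs u) \<longleftrightarrow>
     (\<forall>j<n. \<forall>i<n. blk v i j = mat_adjoint (blk u j i))"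
proof
  assume eq: "Ind_rep e xs sigs v = mat_adjoint (Ind_rep e xs sigs u)"
  show "\<forall>j<n. \<forall>i<n. blk v i j = mat_adjoint (blk u j i)"
  proof (intro allI impI)
    fix j i assume ji: "j < n" "i < n"
    note c = blk_carrier[OF ji(1), of u i] blk_carrier[OF ji(2), of v j]
    show "blk v i j = mat_adjoint (blk u j i)"
    proof (rule eq_matI)
      fix r s assume "r < dim_row (mat_adjoint (blk u j i))" "s < dim_col (mat_adjoint (blk u j i))"
      hence rs: "r < D" "s < D" using c by auto
      have "blk v i j $$ (r, s) = mat_adjoint (Ind_rep e xs sigs u) $$ (i * D + r, j * D + s)"
        using Ind_entry[OF ji(2,1) rs, of v] eq by simp
      also have "\<dots> = cnj (Ind_rep e xs sigs u $$ (j * D + s, i * D + r))"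
        using Ind_carrier[of u] ji rs by (intro mat_adjoint_index) (auto simp: block_index_less)
      finally show "blk v i j $$ (r, s) = mat_adjoint (blk u j i) $$ (r, s)"
        using Ind_entry[OF ji rs(2,1), of u] c rs by simp
    qed (use c in auto)
  qed
next
  assume blk: "\<forall>j<n. \<forall>i<n. blk v i j = mat_adjoint (blk u j i)"
  show "Ind_rep e xs sigs v = mat_adjoint (Ind_rep e xs sigs u)"
  proof (rule eq_block_matI[OF Ind_carrier mat_adjoint_carrier[OF Ind_carrier] D_pos])
    fix j i r s assume ji: "j < n" "i < n" and rs: "r < D" "s < D"
    have "mat_adjoint (Ind_rep e xs sigs u) $$ (j * D + r, i * D + s) =
        cnj (Ind_rep e xs sigs u $$ (i * D + s, j * D + r))"
      using Ind_carrier[of u] ji rs by (intro mat_adjoint_index) (auto simp: block_index_less)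
    also have "\<dots> = mat_adjoint (blk u i j) $$ (r, s)"
      using Ind_entry[OF ji(2,1) rs(2,1), of u] blk_carrier[OF ji(2), of u j] rs by simp
    also have "\<dots> = Ind_rep e xs sigs v $$ (j * D + r, i * D + s)"
      using Ind_entry[OF ji rs, of v] blk ji by simp
    finally show "Ind_rep e xs sigs v $$ (j * D + r, i * D + s) =
        mat_adjoint (Ind_rep e xs sigs u) $$ (j * D + r, i * D + s)" ..
  qed
qed

text \<open>Column \<open>i\<close> of \<open>v\<close> has at most one nonzero block, at the index
  \<open>k\<close> of the coset containing \<open>v * xs!i\<close>, so the sum has at most one
  nonzero term. If \<open>v * xs!i\<close> leaves the L-class, the column is zero and
  \<open>L_class_of_mult\<close> keeps \<open>u * v * xs!i\<close> outside.\<close>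

lemma blk_mult:
  assumes ji: "j < n" "i < n" and rs: "r < D" "s < D"
  shows "blk (u * v) j i $$ (r, s) = (\<Sum>k<n. (blk u j k * blk v k i) $$ (r, s))"
proof (cases "v * xs!i \<in> L_class e")
  case True
  then obtain k g where k: "k < n" and g: "g \<in> H_group e" and vx: "v * xs!i = xs!k * g"
    by (rule L_class_decomp)
  have "blk v l i = 0\<^sub>m D D" if "l < n" "l \<noteq> k" for l
    using transversal_unique[OF k that(1) g] vx that by (intro blk_zero) auto
  hence "(blk u j l * blk v l i) $$ (r, s) = 0" if "l < n" "l \<noteq> k" for l
    using that right_mult_zero_mat[OF blk_carrier[OF ji(1)]] rs by simp
  hence "(\<Sum>l<n. (blk u j l * blk v l i) $$ (r, s)) =
      (\<Sum>l<n. if l = k then (blk u j k * blk v k i) $$ (r, s) else 0)"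
    by (intro sum.cong) auto
  hence sum: "(\<Sum>l<n. (blk u j l * blk v l i) $$ (r, s)) = (blk u j k * \<sigma> g) $$ (r, s)"
    using k blk_eq[OF k g vx] by simp
  show ?thesis
  proof (cases "\<exists>h\<in>H_group e. u * xs!k = xs!j * h")
    case True
    then obtain h where h: "h \<in> H_group e" "u * xs!k = xs!j * h" by blast
    have "(u * v) * xs!i = xs!j * (h * g)"
      using vx h by (metis mult.assoc)
    hence "blk (u * v) j i = \<sigma> (h * g)" using h g by (intro blk_eq[OF ji(1)]) auto
    thus ?thesis unfolding sum using blk_eq[OF ji(1) h] \<sigma>_mult[OF h(1) g] by simp
  next
    case False
    have "blk (u * v) j i = 0\<^sub>m D D"
    proof (rule blk_zero)
      fix h assume h: "h \<in> H_group e"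
      show "(u * v) * xs!i \<noteq> xs!j * h"
      proof
        assume "(u * v) * xs!i = xs!j * h"
        \<comment> \<open>Cancelling \<open>g\<close> on the right turns a nonzero block of the
          product into a nonzero block of \<open>u\<close> at (j, k), against the case
          assumption.\<close>
        hence "u * xs!k * g * H_inv e g = xs!j * h * H_inv e g" using vx by (metis mult.assoc)
        hence "u * (xs!k * e) = xs!j * (h * H_inv e g)" using g by (simp add: mult.assoc)
        hence "u * xs!k = xs!j * (h * H_inv e g)" using xs_L[OF k] idem by (simp add: L_class_iff)
        thus False using False g h by auto
      qed
    qed
    moreover have "blk u j k = 0\<^sub>m D D" using False by (intro blk_zero) auto
    ultimately show ?thesis unfolding sum
      using left_mult_zero_mat[OF \<sigma>_carrier[OF g]] rs by simp
  qed
next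
  case False
  have "blk v k i = 0\<^sub>m D D" if "k < n" for k
    using False L_class_mult_H[OF idem xs_L[OF that]] by (intro blk_zero) auto
  hence "(\<Sum>k<n. (blk u j k * blk v k i) $$ (r, s)) = 0"
    using right_mult_zero_mat[OF blk_carrier[OF ji(1)]] rs by simp
  moreover have "blk (u * v) j i = 0\<^sub>m D D"
  proof (rule blk_zero)
    fix h assume h: "h \<in> H_group e"
    show "(u * v) * xs!i \<noteq> xs!j * h"
    proof
      assume "(u * v) * xs!i = xs!j * h"
      hence "u * (v * xs!i) \<in> L_class e"
        using L_class_mult_H[OF idem xs_L[OF ji(1)] h] by (simp add: mult.assoc)
      moreover have "v * xs!i * e = v * xs!i" using xs_L[OF ji(2)] idem by (simp add: L_class_iff mult.assoc)
      ultimately show False using False L_class_of_mult[OF idem] by blast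
    qed
  qed
  ultimately show ?thesis using rs by simp
qed

lemma Ind_mult: "Ind_rep e xs sigs (u * v) = Ind_rep e xs sigs u * Ind_rep e xs sigs v"
proof (rule eq_block_matI[OF Ind_carrier mult_carrier_mat[OF Ind_carrier Ind_carrier] D_pos])
  fix j i r s assume ji: "j < n" "i < n" and rs: "r < D" "s < D"
  have "(Ind_rep e xs sigs u * Ind_rep e xs sigs v) $$ (j * D + r, i * D + s) =
    (\<Sum>p<n * D. Ind_rep e xs sigs u $$ (j * D + r, p) * Ind_rep e xs sigs v $$ (p, i * D + s))"
    by (rule mult_mat_entry[OF Ind_carrier Ind_carrier])
       (rule block_index_less[OF ji(1) rs(1)], rule block_index_less[OF ji(2) rs(2)])
  also have "\<dots> = (\<Sum>k<n. \<Sum>t<D. blk u j k $$ (r, t) * blk v k i $$ (t, s))"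
    unfolding sum_blocks using ji rs by (simp add: Ind_entry)
  also have "\<dots> = (\<Sum>k<n. (blk u j k * blk v k i) $$ (r, s))"
  proof (rule sum.cong[OF refl])
    fix k assume "k \<in> {..<n}"
    thus "(\<Sum>t<D. blk u j k $$ (r, t) * blk v k i $$ (t, s)) = (blk u j k * blk v k i) $$ (r, s)"
      using mult_mat_entry[OF blk_carrier[OF ji(1)] blk_carrier rs] by simp
  qed
  also have "\<dots> = Ind_rep e xs sigs (u * v) $$ (j * D + r, i * D + s)"
    unfolding blk_mult[OF ji rs, symmetric] Ind_entry[OF ji rs] ..
  finally show "Ind_rep e xs sigs (u * v) $$ (j * D + r, i * D + s) =
    (Ind_rep e xs sigs u * Ind_rep e xs sigs v) $$ (j * D + r, i * D + s)" ..
qed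

text \<open>A defined product \<open>u * x\<close> corresponds to a block with a group element. The
  same block in the matrix of \<open>v\<close> is nonzero, so \<open>v\<close> is defined there too,
  and faithfulness of \<open>\<sigma>\<close> identifies the group elements.\<close>

lemma Ind_eq_imp:
  assumes eq: "Ind_rep e xs sigs u = Ind_rep e xs sigs v"
    and x: "x \<in> L_class e" and ux: "u * x \<in> L_class e"
  shows "v * x = u * x"
proof -
  obtain i g where i: "i < n" and g: "g \<in> H_group e" and xi: "x = xs!i * g"
    using x by (rule L_class_decomp)
  obtain j h where j: "j < n" and h: "h \<in> H_group e" and uj: "u * x = xs!j * h"
    using ux by (rule L_class_decomp)
  \<comment> \<open>Passes from \<open>x = xs!i * g\<close> to the representative
    \<open>xs!i\<close>, on which the blocks are defined.\<close>
  have "u * xs!i = u * (xs!i * (g * H_inv e g))" using xs_L[OF i] idem g by (simp add: L_class_iff)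
  also have "\<dots> = u * x * H_inv e g" by (simp add: xi mult.assoc)
  also have "\<dots> = xs!j * (h * H_inv e g)" by (simp add: uj mult.assoc)
  finally have ui: "u * xs!i = xs!j * (h * H_inv e g)" .
  have k: "h * H_inv e g \<in> H_group e" using g h by simp
  have bu: "blk u j i = \<sigma> (h * H_inv e g)" by (rule blk_eq[OF j k ui])
  hence bv: "blk v j i = \<sigma> (h * H_inv e g)" using eq i j by (simp add: Ind_eq_iff)
  then obtain k' where k': "k' \<in> H_group e" "v * xs!i = xs!j * k'" "blk v j i = \<sigma> k'"
    using blk_nonzeroE[OF j, of v i] \<sigma>_nonzero[OF k] by metis
  have "k' = h * H_inv e g"
    using complete_irreps_faithful[OF complete k'(1) k] k'(3) bv by simp
  hence "v * xs!i = u * xs!i" using k' ui by simp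
  thus ?thesis unfolding xi by (metis mult.assoc)
qed

end

section \<open>Involutions\<close>

lemma (in induced_rep) regular_star_of_Ind:
  assumes J: "e \<in> J_class a" and reg: "a * a' * a = a"
    and semi: "semiunitary (Ind_rep e xs sigs)" and st: "star_rep star (Ind_rep e xs sigs)"
  shows "a * star a * a = a"
proof -
  obtain x y where x: "x \<in> L_class e" "a * x \<in> L_class e" "a' * a = x * y"
    by (rule J_class_factorization[OF idem J reg])
  have "Ind_rep e xs sigs a = Ind_rep e xs sigs (a * star a * a)"
    using semi st by (simp add: semiunitary_def star_rep_def Ind_mult)
  hence eq: "(a * star a * a) * x = a * x" using x by (intro Ind_eq_imp) auto
  \<comment> \<open>Both \<open>a\<close> and \<open>a * star a * a\<close> end in \<open>a\<close>
    and so absorb \<open>a' * a = x * y\<close> on the right; agreement at \<open>x\<close> is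
    therefore enough.\<close>
  have "a * star a * a = (a * star a * a) * (a' * a)" using reg by (simp add: mult.assoc)
  also have "\<dots> = (a * star a * a) * x * y" by (simp add: x(3) mult.assoc)
  also have "\<dots> = a * (a' * a)" unfolding eq by (simp add: x(3) mult.assoc)
  also have "\<dots> = a" using reg by (simp add: mult.assoc)
  finally show ?thesis .
qed

text \<open>An idempotent acts on the columns of \<open>Ind\<close> by a partial map fixing its image pointwise;
  the adjoint being of the same shape forces this partial map to be a partial identity.\<close>

lemma (in induced_rep) Ind_idempotent_star:
  assumes f: "f * f = f" and st: "star_rep star (Ind_rep e xs sigs)"
  shows "Ind_rep e xs sigs (star f) = Ind_rep e xs sigs f"
proof -
  have adj: "blk (star f) i j = mat_adjoint (blk f j i)" if "i < n" "j < n" for i j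
  proof -
    have "Ind_rep e xs sigs (star f) = mat_adjoint (Ind_rep e xs sigs f)"
      using st by (simp add: star_rep_def)
    thus ?thesis using that unfolding Ind_adjoint_iff by blast
  qed
  have adj_nz: "mat_adjoint (\<sigma> g) \<noteq> 0\<^sub>m D D" if g: "g \<in> H_group e" for g
  proof
    assume "mat_adjoint (\<sigma> g) = 0\<^sub>m D D"
    hence "\<sigma> g = mat_adjoint (0\<^sub>m D D)" by (metis mat_adjoint_adjoint)
    also have "\<dots> = 0\<^sub>m D D" by (rule eq_matI) auto
    finally show False using \<sigma>_nonzero[OF g] by simp
  qed
  \<comment> \<open>Since \<open>xs!j * g\<close> is in the image of \<open>f\<close>, the
    idempotent fixes \<open>xs!j\<close>, and its blocks (j, i) and (j, j) are both nonzero. In the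
    adjoint they become two nonzero blocks of column \<open>j\<close>, which has room for only
    one.\<close>
  have diag: "i = j \<and> g = e"
    if ij: "i < n" "j < n" and g: "g \<in> H_group e" and fx: "f * xs!i = xs!j * g" for i j g
  proof -
    have xj: "xs!j * e = xs!j" using xs_L[OF ij(2)] idem by (simp add: L_class_iff)
    have "f * (xs!j * g) = xs!j * g" using fx f by (metis mult.assoc)
    hence "f * (xs!j * g) * H_inv e g = xs!j * g * H_inv e g" by simp
    hence fj: "f * xs!j = xs!j * e" using g xj by (simp add: mult.assoc)
    have "blk (star f) j j \<noteq> 0\<^sub>m D D"
      unfolding adj[OF ij(2) ij(2)] blk_eq[OF ij(2) e_in fj] by (rule adj_nz) simp
    then obtain h where h: "h \<in> H_group e" "star f * xs!j = xs!j * h"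
      using blk_nonzeroE[OF ij(2)] by metis
    have "blk (star f) i j \<noteq> 0\<^sub>m D D"
      unfolding adj[OF ij] blk_eq[OF ij(2) g fx] by (rule adj_nz[OF g])
    then obtain h' where h': "h' \<in> H_group e" "star f * xs!j = xs!i * h'"
      using blk_nonzeroE[OF ij(1)] by metis
    have ji: "i = j" using transversal_unique[OF ij h'(1) h(1)] h h' by simp
    have "xs!j * g = xs!j * e" using fx fj ji by simp
    hence "g = e" by (rule L_class_cancel[OF idem xs_L[OF ij(2)] g e_in])
    thus ?thesis using ji by simp
  qed
  have "blk (star f) j i = blk f j i" if ji: "j < n" "i < n" for j i
  \<comment> \<open>The case distinction concerns the transposed block (i, j) of \<open>f\<close>,
    whose adjoint is the block (j, i) of \<open>star f\<close>.\<close>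
  proof (cases "\<exists>g\<in>H_group e. f * xs!j = xs!i * g")
    case True
    then obtain g where g: "g \<in> H_group e" "f * xs!j = xs!i * g" by blast
    hence "j = i" "g = e" using diag[OF ji g] by auto
    hence b: "blk f j i = 1\<^sub>m D" "blk f i j = 1\<^sub>m D" using blk_eq[OF ji(2) g] \<sigma>_e by auto
    show ?thesis unfolding adj[OF ji] b by (rule eq_matI) auto
  next
    case False
    hence z: "blk f i j = 0\<^sub>m D D" by (intro blk_zero) auto
    have "blk f j i = 0\<^sub>m D D"
    proof (rule blk_zero)
      fix g assume g: "g \<in> H_group e"
      show "f * xs!i \<noteq> xs!j * g"
      proof
        assume "f * xs!i = xs!j * g"
        hence "i = j" using diag[OF ji(2,1) g] by simp
        thus False using False \<open>f * xs!i = xs!j * g\<close> g by auto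
      qed
    qed
    thus ?thesis unfolding adj[OF ji] z by (intro eq_matI) auto
  qed
  thus ?thesis by (simp add: Ind_eq_iff)
qed

section \<open>From the induced representation back to the involution\<close>

locale star_semigroup =
  fixes star :: "'a::{semigroup_mult,finite} \<Rightarrow> 'a"
  assumes star_star [simp]: "star (star a) = a"
    and star_mult: "star (a * b) = star b * star a"
begin

text \<open>Agreement of \<open>star f\<close> and \<open>f\<close> on \<open>x\<close> gives
  \<open>star f * f = f\<close> after multiplication by \<open>y\<close>. The left side is
  self-adjoint, hence so is \<open>f\<close>.\<close>

lemma idempotent_star_of_Ind:
  assumes ir: "induced_rep e xs sigs" and J: "e \<in> J_class f" and f: "f * f = f"
    and st: "star_rep star (Ind_rep e xs sigs)"
  shows "star f = f"
proof -
  interpret induced_rep e xs sigs by (rule ir)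
  obtain x y where x: "x \<in> L_class e" "f * x \<in> L_class e" "f * f = x * y"
    by (rule J_class_factorization[OF idem J, of f]) (use f in auto)
  have "star f * x = f * x"
    using Ind_idempotent_star[OF f st] x by (intro Ind_eq_imp) auto
  hence "star f * (x * y) = f * (x * y)" by (metis mult.assoc)
  hence sf: "star f * f = f" using x(3) f by simp
  have "star f = star (star f * f)" by (simp add: sf)
  also have "\<dots> = star f * f" by (simp only: star_mult star_star)
  also note sf
  finally show ?thesis .
qed

end

text \<open>The meeting point of the two directions: these two laws come from the representations in
  the one, and from uniqueness of inverses in the other.\<close>

locale inverse_star_semigroup = star_semigroup star
  for star :: "'a::{semigroup_mult,finite} \<Rightarrow> 'a" +
  assumes star_regular: "s * star s * s = s"
    and star_idem: "f * f = f \<Longrightarrow> star f = f"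
begin

text \<open>Regularity of \<open>f * g\<close>, whose star is \<open>g * f\<close>, makes
  \<open>f * g\<close> idempotent. It is then self-adjoint, which says that it equals
  \<open>g * f\<close>.\<close>

lemma idempotents_commute:
  fixes f g :: 'a
  assumes f: "f * f = f" and g: "g * g = g"
  shows "f * g = g * f"
proof -
  have s: "star (f * g) = g * f" using f g by (simp add: star_mult star_idem)
  have "f * g = (f * g) * (g * f) * (f * g)" using star_regular[of "f * g"] s by simp
  also have "\<dots> = (f * g) * (f * g)" using f g by (metis mult.assoc)
  finally have "star (f * g) = f * g" by (intro star_idem) simp
  thus ?thesis using s by simp
qed

lemma inverse: "inverse_semigroup TYPE('a)"
  unfolding inverse_semigroup_def
proof (intro allI ex1I[of _ "star _"] conjI)
  fix a :: 'a
  show "a * star a * a = a" by (rule star_regular)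
  show "star a * a * star a = star a" using star_regular[of "star a"] by simp
  fix b assume b: "a * b * a = a \<and> b * a * b = b"
  let ?c = "star a"
  have c: "a * ?c * a = a" "?c * a * ?c = ?c" using star_regular[of a] star_regular[of "star a"] by auto
  have i: "(a * b) * (a * b) = a * b" "(a * ?c) * (a * ?c) = a * ?c"
    "(b * a) * (b * a) = b * a" "(?c * a) * (?c * a) = ?c * a"
    using b c by (simp_all add: mult.assoc[symmetric])
  \<comment> \<open>The usual comparison of two inverses: insert \<open>?c\<close> inside
    \<open>b * a * b\<close>, and exchange commuting idempotents until \<open>b\<close> is
    absorbed.\<close>
  have "b = b * (a * ?c * a) * b" using b c by simp
  also have "\<dots> = b * ((a * ?c) * (a * b))" by (simp add: mult.assoc)
  also have "\<dots> = b * ((a * b) * (a * ?c))" using idempotents_commute[OF i(2,1)] by simp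
  also have "\<dots> = (b * a * b) * (a * ?c)" by (simp add: mult.assoc)
  also have "\<dots> = b * a * (?c * a * ?c)" using b c by (simp add: mult.assoc)
  also have "\<dots> = ((b * a) * (?c * a)) * ?c" by (simp add: mult.assoc)
  also have "\<dots> = ((?c * a) * (b * a)) * ?c" using idempotents_commute[OF i(3,4)] by simp
  also have "\<dots> = ?c * (a * b * a) * ?c" by (simp add: mult.assoc)
  also have "\<dots> = ?c" using b c by simp
  finally show "b = ?c" .
qed

section \<open>Adjoints of the partial action, and construction of the pair\<close>

lemma L_class_star_mult:
  assumes e: "e * e = e" and x: "x \<in> L_class e"
  shows "star x * x = e"
proof -
  obtain t where t: "x * e = x" "t * x = e" using x e by (auto simp: L_class_iff)
  have "e * (star x * x) = t * (x * star x * x)" using t by (metis mult.assoc)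
  hence 1: "e * (star x * x) = e" using t star_regular by simp
  have "star x * x * e = star x * x" using t by (simp add: mult.assoc)
  \<comment> \<open>Both \<open>e\<close> and \<open>star x * x\<close> are self-adjoint, so
    applying \<open>star\<close> turns absorption of \<open>e\<close> on the right into absorption
    on the left.\<close>
  hence "star (star x * x * e) = star (star x * x)" by simp
  hence "e * (star x * x) = star x * x" using star_idem[OF e] by (simp add: star_mult)
  thus ?thesis using 1 by simp
qed

lemma star_R_class:
  assumes e: "e * e = e"
  shows "star x \<in> R_class e \<longleftrightarrow> x \<in> L_class e"
proof -
  have se: "star e = e" by (rule star_idem[OF e])
  have "e * star x = star x \<longleftrightarrow> x * e = x" by (metis se star_mult star_star)
  moreover have "(\<exists>t. star x * t = e) \<longleftrightarrow> (\<exists>t. t * x = e)" by (metis se star_mult star_star)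
  ultimately show ?thesis using e by (simp add: L_class_iff R_class_iff)
qed

lemma star_H_group:
  assumes e: "e * e = e" and g: "g \<in> H_group e"
  shows "star g \<in> H_group e"
  using g star_R_class[OF e, of g] star_R_class[OF e, of "star g"] by (simp add: H_group_def)

text \<open>Translates unitarity, which concerns the group inverse, into compatibility of
  \<open>\<sigma>\<close> with \<open>star\<close>.\<close>

lemma star_H_inv:
  assumes e: "e * e = e" and g: "g \<in> H_group e"
  shows "star g = H_inv e g"
proof -
  interpret subgroup_of_semigroup "H_group e" e "H_inv e" by (rule subgroup_H_group[OF e])
  have sg: "star g \<in> H_group e" by (rule star_H_group[OF e g])
  have "star g * g = e" using g by (intro L_class_star_mult[OF e]) (simp add: H_group_def)
  hence "g = H_inv e (star g)" by (rule gi_unique[OF sg g])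
  thus ?thesis using sg by (metis gi_gi)
qed

text \<open>From \<open>u * x = y * g\<close> one gets \<open>star x * (star u * u) * x = e\<close>.
  Commuting the idempotents \<open>star u * u\<close> and \<open>x * star x\<close> yields
  \<open>star u * u * x = x\<close>: where \<open>u\<close> is defined, \<open>star u\<close> undoes
  it. Applied to \<open>star u\<close>, the lemma gives its own converse.\<close>

lemma L_class_adjoint:
  assumes e: "e * e = e" and x: "x \<in> L_class e" and y: "y \<in> L_class e"
    and g: "g \<in> H_group e" and eq: "u * x = y * g"
  shows "star u * y = x * star g"
proof -
  interpret subgroup_of_semigroup "H_group e" e "H_inv e" by (rule subgroup_H_group[OF e])
  have gg: "star g * g = e" "g * star g = e" using g by (simp_all add: star_H_inv[OF e])
  have "star x * (star u * u) * x = star (u * x) * (u * x)" by (simp add: star_mult mult.assoc)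
  also have "\<dots> = star g * (star y * y) * g" by (simp add: eq star_mult mult.assoc)
  also have "\<dots> = e" using L_class_star_mult[OF e y] star_H_group[OF e g] gg by simp
  finally have 1: "star x * (star u * u) * x = e" .
  have i: "(star u * u) * (star u * u) = star u * u" "(x * star x) * (x * star x) = x * star x"
    using star_regular[of "star u"] star_regular[of x] by (simp_all add: mult.assoc[symmetric])
  have "star u * u * x = (star u * u) * (x * star x) * x"
    using star_regular[of x] by (simp add: mult.assoc)
  also have "\<dots> = (x * star x) * (star u * u) * x" by (simp add: idempotents_commute[OF i])
  also have "\<dots> = x * (star x * (star u * u) * x)" by (simp add: mult.assoc)
  also have "\<dots> = x" using 1 x e by (simp add: L_class_iff)
  finally have 2: "star u * u * x = x" .
  have "star u * y = star u * (y * (g * star g))" using y e gg by (simp add: L_class_iff)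
  also have "\<dots> = star u * (u * x) * star g" by (simp add: eq mult.assoc)
  also have "\<dots> = x * star g" using 2 by (simp add: mult.assoc)
  finally show ?thesis .
qed

lemma right_transversal_star:
  assumes e: "e * e = e" and t: "left_transversal e xs"
  shows "right_transversal e (map star xs)"
proof -
  have inj: "inj star" by (rule inj_on_inverseI[of _ star]) simp
  have co: "(\<lambda>g. g * star x) ` H_group e = star ` ((\<lambda>g. x * g) ` H_group e)" for x
  proof -
    have "star ` H_group e = H_group e"
      using star_H_group[OF e] by (metis star_star subsetI subset_antisym image_subsetI image_eqI)
    moreover have "(\<lambda>g. g * star x) ` star ` H_group e = star ` ((\<lambda>g. x * g) ` H_group e)"
      by (simp add: image_image star_mult)
    ultimately show ?thesis by simp
  qed
  have R: "R_class e = star ` L_class e"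
  proof (intro equalityI subsetI)
    fix z assume "z \<in> R_class e"
    hence "star z \<in> L_class e" using star_R_class[OF e, of "star z"] by simp
    thus "z \<in> star ` L_class e" by (intro image_eqI[of _ _ "star z"]) simp_all
  qed (use star_R_class[OF e] in auto)
  note lt = t[unfolded left_transversal_def]
  note sub = conjunct1[OF lt] and Leq = conjunct1[OF conjunct2[OF lt]] and dis = conjunct2[OF conjunct2[OF lt]]
  show ?thesis
    unfolding right_transversal_def
  proof (intro conjI allI impI)
    show "set (map star xs) \<subseteq> R_class e" using sub unfolding R by auto
    have "R_class e = (\<Union>i<length xs. star ` ((\<lambda>g. xs!i * g) ` H_group e))"
      unfolding R by (subst Leq) (rule image_UN)
    also have "\<dots> = (\<Union>i<length (map star xs). (\<lambda>g. g * map star xs ! i) ` H_group e)"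
      using co by simp
    finally show "R_class e = (\<Union>i<length (map star xs). (\<lambda>g. g * map star xs ! i) ` H_group e)" .
    fix i j assume "i < length (map star xs)" "j < length (map star xs)" "i \<noteq> j"
    thus "(\<lambda>g. g * map star xs ! i) ` H_group e \<inter> (\<lambda>g. g * map star xs ! j) ` H_group e = {}"
      using dis by (simp add: co image_Int[OF inj, symmetric])
  qed
qed

text \<open>Applying \<open>star\<close> to \<open>star (xs!j) * u = h * star (xs!i)\<close> gives
  \<open>star u * xs!j = xs!i * star h\<close>, and \<open>L_class_adjoint\<close> turns this into
  \<open>u * xs!i = xs!j * h\<close>. Two reversals cancel, so the same \<open>h\<close> appears in
  the same block and no transpose is left.\<close>

lemma Coind_eq_Ind:
  assumes e: "e * e = e" and t: "left_transversal e xs"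
  shows "Coind_rep e (map star xs) sigs u = Ind_rep e xs sigs u"
proof -
  have xs_L: "xs ! i \<in> L_class e" if "i < length xs" for i
    using conjunct1[OF t[unfolded left_transversal_def]] that by (auto dest: subsetD)
  have iff: "star (xs!j) * u = h * star (xs!i) \<longleftrightarrow> u * xs!i = xs!j * h"
    if "j < length xs" "i < length xs" "h \<in> H_group e" for i j h
  proof
    assume "star (xs!j) * u = h * star (xs!i)"
    hence "star (star (xs!j) * u) = star (h * star (xs!i))" by simp
    hence "star u * xs!j = xs!i * star h" by (simp add: star_mult)
    from L_class_adjoint[OF e xs_L[OF that(1)] xs_L[OF that(2)] star_H_group[OF e that(3)] this]
    show "u * xs!i = xs!j * h" by simp
  next
    assume "u * xs!i = xs!j * h"
    from L_class_adjoint[OF e xs_L[OF that(2)] xs_L[OF that(1)] that(3) this]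
    have "star (star u * xs!j) = star (xs!i * star h)" by simp
    thus "star (xs!j) * u = h * star (xs!i)" by (simp add: star_mult)
  qed
  have L: "xs!j * h \<in> L_class e" if "j < length xs" "h \<in> H_group e" for j h
    by (rule L_class_mult_H[OF e xs_L[OF that(1)] that(2)])
  have R: "h * star (xs!i) \<in> R_class e" if "i < length xs" "h \<in> H_group e" for i h
  proof -
    have "xs!i * star h \<in> L_class e" by (rule L[OF that(1) star_H_group[OF e that(2)]])
    thus ?thesis using star_R_class[OF e, of "xs!i * star h"] by (simp add: star_mult)
  qed
  have cond: "(star (xs!j) * u \<in> R_class e \<and> (\<exists>h\<in>H_group e. star (xs!j) * u = h * star (xs!i))) \<longleftrightarrow>
      (u * xs!i \<in> L_class e \<and> (\<exists>g\<in>H_group e. u * xs!i = xs!j * g))"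
    and the: "(THE h. h \<in> H_group e \<and> star (xs!j) * u = h * star (xs!i)) =
      (THE g. g \<in> H_group e \<and> u * xs!i = xs!j * g)"
    if ji: "j < length xs" "i < length xs" for i j
  proof -
    show "(THE h. h \<in> H_group e \<and> star (xs!j) * u = h * star (xs!i)) =
      (THE g. g \<in> H_group e \<and> u * xs!i = xs!j * g)"
      by (rule arg_cong[where f = The]) (use iff[OF ji] in auto)
    have "(\<exists>h\<in>H_group e. star (xs!j) * u = h * star (xs!i)) \<longleftrightarrow>
        (\<exists>g\<in>H_group e. u * xs!i = xs!j * g)" using iff[OF ji] by blast
    moreover have "star (xs!j) * u \<in> R_class e" if "\<exists>h\<in>H_group e. star (xs!j) * u = h * star (xs!i)"
      using that R[OF ji(2)] by auto
    moreover have "u * xs!i \<in> L_class e" if "\<exists>g\<in>H_group e. u * xs!i = xs!j * g"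
      using that L[OF ji(1)] by auto
    ultimately show "(star (xs!j) * u \<in> R_class e \<and> (\<exists>h\<in>H_group e. star (xs!j) * u = h * star (xs!i))) \<longleftrightarrow>
      (u * xs!i \<in> L_class e \<and> (\<exists>g\<in>H_group e. u * xs!i = xs!j * g))" by blast
  qed
  show ?thesis
  proof (rule eq_matI)
    fix p q assume "p < dim_row (Ind_rep e xs sigs u)" "q < dim_col (Ind_rep e xs sigs u)"
    hence pq: "p < length xs * rep_dim sigs" "q < length xs * rep_dim sigs"
      by (auto simp: Ind_rep_def Let_def)
    hence d: "p div rep_dim sigs < length xs" "q div rep_dim sigs < length xs"
      by (auto simp: less_mult_imp_div_less)
    show "Coind_rep e (map star xs) sigs u $$ (p, q) = Ind_rep e xs sigs u $$ (p, q)"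
    proof -
      let ?i = "q div rep_dim sigs" and ?j = "p div rep_dim sigs"
      let ?rs = "(p mod rep_dim sigs, q mod rep_dim sigs)"
      have "Coind_rep e (map star xs) sigs u $$ (p, q) =
          (if star (xs!?j) * u \<in> R_class e \<and> (\<exists>h\<in>H_group e. star (xs!?j) * u = h * star (xs!?i))
           then direct_sum_rep sigs (THE h. h \<in> H_group e \<and> star (xs!?j) * u = h * star (xs!?i)) $$ ?rs
           else 0)"
        using pq d by (auto simp: Coind_rep_def Let_def)
      also have "\<dots> = (if u * xs!?i \<in> L_class e \<and> (\<exists>g\<in>H_group e. u * xs!?i = xs!?j * g)
           then direct_sum_rep sigs (THE g. g \<in> H_group e \<and> u * xs!?i = xs!?j * g) $$ ?rs else 0)"
        unfolding cond[OF d] the[OF d] ..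
      also have "\<dots> = Ind_rep e xs sigs u $$ (p, q)"
        using pq by (auto simp: Ind_rep_def Let_def)
      finally show ?thesis .
    qed
  qed (simp_all add: Coind_rep_def Ind_rep_def Let_def)
qed

lemma good_pair: "good_schutzenberger_pair star a"
proof -
  define e where "e = a * star a"
  have e: "e * e = e" using star_regular[of a] by (simp add: e_def mult.assoc[symmetric])
  have "a = e * a" using star_regular[of a] by (simp add: e_def)
  hence "two_ideal a \<subseteq> two_ideal e" using two_ideal_mult_subset(2)[of e a] by simp
  moreover have "two_ideal e \<subseteq> two_ideal a" unfolding e_def by (rule two_ideal_mult_subset(2))
  ultimately have J: "e \<in> J_class a" by (auto simp: J_class_def)
  obtain xs where xs: "left_transversal e xs" by (rule left_transversal_exists[OF e])
  interpret fs: finite_subgroup "H_group e" e "H_inv e"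
    using subgroup_H_group[OF e] by (auto simp: finite_subgroup_def finite_subgroup_axioms_def)
  obtain sigs where c: "complete_irreps (H_group e) e sigs" and un: "fs.inequivalent_unitary sigs"
    by (rule fs.complete_unitary_irreps_exist)
  interpret induced_rep e xs sigs using e xs c by unfold_locales
  have \<sigma>_star: "\<sigma> (star g) = mat_adjoint (\<sigma> g)" if g: "g \<in> H_group e" for g
  proof (rule direct_sum_rep_adjoint, rule ballI)
    fix p assume "p \<in> set sigs"
    hence "fs.unitary_irrep (fst p) (snd p)"
      using un by (auto simp: fs.inequivalent_unitary_def in_set_conv_nth)
    thus "snd p g \<in> carrier_mat (fst p) (fst p) \<and> snd p (star g) = mat_adjoint (snd p g)"
      using fs.unitary_irrepD(4,6) g star_H_inv[OF e g] by auto
  qed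
  have blk_star: "blk (star u) i j = mat_adjoint (blk u j i)" if ji: "j < n" "i < n" for u i j
  proof (cases "\<exists>g\<in>H_group e. u * xs!i = xs!j * g")
    case True
    then obtain g where g: "g \<in> H_group e" "u * xs!i = xs!j * g" by blast
    have "star u * xs!j = xs!i * star g" by (rule L_class_adjoint[OF e xs_L[OF ji(2)] xs_L[OF ji(1)] g])
    hence "blk (star u) i j = \<sigma> (star g)" by (rule blk_eq[OF ji(2) star_H_group[OF e g(1)]])
    thus ?thesis using blk_eq[OF ji(1) g] \<sigma>_star[OF g(1)] by simp
  next
    case False
    hence "blk u j i = 0\<^sub>m D D" by (intro blk_zero) auto
    moreover have "blk (star u) i j = 0\<^sub>m D D"
    proof (rule blk_zero)
      fix h assume h: "h \<in> H_group e"
      show "star u * xs!j \<noteq> xs!i * h"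
      proof
        assume "star u * xs!j = xs!i * h"
        \<comment> \<open>A nonzero block of \<open>star u\<close> would produce one of
          \<open>u\<close> in the transposed position, because \<open>star\<close> is an
          involution.\<close>
        from L_class_adjoint[OF e xs_L[OF ji(1)] xs_L[OF ji(2)] h this]
        show False using False star_H_group[OF e h] by auto
      qed
    qed
    ultimately show ?thesis by (auto intro!: eq_matI)
  qed
  have st: "star_rep star (Ind_rep e xs sigs)"
    unfolding star_rep_def Ind_adjoint_iff using blk_star by blast
  \<comment> \<open>For a multiplicative star representation, semiunitarity is just the image of
    \<open>u * star u * u = u\<close>.\<close>
  have "Ind_rep e xs sigs u * mat_adjoint (Ind_rep e xs sigs u) * Ind_rep e xs sigs u =
      Ind_rep e xs sigs (u * star u * u)" for u
    using st by (simp add: star_rep_def Ind_mult)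
  hence semi: "semiunitary (Ind_rep e xs sigs)" by (simp add: semiunitary_def star_regular)
  have "Coind_rep e (map star xs) sigs = Ind_rep e xs sigs"
    using Coind_eq_Ind[OF e xs] by (intro ext)
  thus ?thesis unfolding good_schutzenberger_pair_def
    using J e xs right_transversal_star[OF e xs] c st semi by metis
qed

end

theorem mainTheorem14:
  fixes star :: "'a::{semigroup_mult, finite} \<Rightarrow> 'a"
  assumes "regular_semigroup TYPE('a)"
    and "is_involution star"
  shows "(inverse_semigroup TYPE('a) \<and> (\<forall>s. s * star s * s = s \<and> star s * s * star s = star s))
     \<longleftrightarrow> (\<forall>a::'a. good_schutzenberger_pair star a)"
proof
  interpret star_semigroup star
    by unfold_locales (use assms(2) in \<open>auto simp: is_involution_def\<close>)
  {
    assume inv: "inverse_semigroup TYPE('a) \<and> (\<forall>s. s * star s * s = s \<and> star s * s * star s = star s)"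
    \<comment> \<open>An idempotent is an inverse of itself, and \<open>star f\<close> is another
      inverse, so uniqueness identifies them.\<close>
    have "star f = f" if f: "f * f = f" for f
    proof -
      have "\<exists>!b. f * b * f = f \<and> b * f * b = b" using inv by (simp add: inverse_semigroup_def)
      moreover have "f * star f * f = f \<and> star f * f * star f = star f" using inv by blast
      moreover have "f * f * f = f \<and> f * f * f = f" using f by simp
      ultimately show ?thesis by blast
    qed
    then interpret inverse_star_semigroup star
      using inv by unfold_locales auto
    show "\<forall>a. good_schutzenberger_pair star a" using good_pair by blast
  next
    assume good: "\<forall>a. good_schutzenberger_pair star a"
    have get: "\<exists>e xs sigs. induced_rep e xs sigs \<and> e \<in> J_class a \<and>
        semiunitary (Ind_rep e xs sigs) \<and> star_rep star (Ind_rep e xs sigs)" for a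
      using spec[OF good, of a] unfolding good_schutzenberger_pair_def induced_rep_def by blast
    have "s * star s * s = s" for s
    proof -
      obtain e xs sigs where ir: "induced_rep e xs sigs" and h: "e \<in> J_class s"
        "semiunitary (Ind_rep e xs sigs)" "star_rep star (Ind_rep e xs sigs)" using get by blast
      obtain s' where "s * s' * s = s" using assms(1) unfolding regular_semigroup_def by blast
      thus ?thesis using induced_rep.regular_star_of_Ind[OF ir h(1) _ h(2,3)] by blast
    qed
    moreover have "star f = f" if f: "f * f = f" for f
    proof -
      obtain e xs sigs where "induced_rep e xs sigs" "e \<in> J_class f"
        "star_rep star (Ind_rep e xs sigs)" using get by blast
      thus ?thesis using idempotent_star_of_Ind f by blast
    qed
    ultimately interpret inverse_star_semigroup star by unfold_locales
    show "inverse_semigroup TYPE('a) \<and> (\<forall>s. s * star s * s = s \<and> star s * s * star s = star s)"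
      using inverse star_regular star_regular[of "star _"] by simp
  }
qed

end
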